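(* Consider the system $\dot x(t)=f(x_t,u(t))$, $y(t)=h(x_t)$ described in the context, and assume it is robustly forward complete (RFC). Then the following are equivalent: (a) the system is input-to-output stable (IOS); (b) there exists an output redefinition $\bar h$ of $h$ such that the system $\dot x(t)=f(x_t,u(t))$ with output $y(t)=\bar h(x_t)$ is output-Lagrange input-to-output stable (OL-IOS). Furthermore, if $h$ is locally Lipschitz, then the output redefinition $\bar h$ in (b) can be chosen to be locally Lipschitz on $\mathcal X^n\setminus\{\xi\in\mathcal X^n:\ \bar h(\xi)=0\}$.
   Context: Fix $\theta>0$. For $k\ge 1$, $\mathcal X^k=C([-\theta,0],\mathbb R^k)$ with the norm $\|\xi\|_{\mathcal X}=\max_{s\in[-\theta,0]}|\xi(s)|$ ($|\cdot|$ the Euclidean norm). For a continuous function $v$ on $[-\theta,b]$ and $t\in[0,b]$, $v_t\in\mathcal X^k$ is $v_t(s)=v(t+s)$, $s\in[-\theta,0]$. $\mathcal M$ denotes the set of measurable, locally essentially bounded $u:\mathbb R_{\ge0}\to\mathbb R^m$, and $\|u\|$ is its essential supremum over $[0,\infty)$ (possibly $+\infty$). Class $\mathcal N$: continuous nondecreasing $\sigma:\mathbb R_{\ge0}\to\mathbb R_{\ge0}$ with $\sigma(0)=0$; class $\mathcal K$: strictly increasing members of $\mathcal N$; class $\mathcal K_\infty$: members of $\mathcal K$ that are onto $\mathbb R_{\ge0}$; class $\mathcal{KL}$: $\beta:\mathbb R_{\ge0}^2\to\mathbb R_{\ge0}$ with $\beta(\cdot,t)\in\mathcal K$ for each $t$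 and $\beta(s,t)$ decreasing to $0$ as $t\to\infty$ for each $s$. The system is $\dot x(t)=f(x_t,u(t))$, $y(t)=h(x_t)$, where $f:\mathcal X^n\times\mathbb R^m\to\mathbb R^n$ is locally Lipschitz and maps bounded sets to bounded sets, and $h:\mathcal X^n\to\mathbb R^p$ is continuous with $|h(\xi)|\le\pi(\|\xi\|_{\mathcal X})$ for some $\pi\in\mathcal N$. For $\xi\in\mathcal X^n$, $u\in\mathcal M$, $x(\cdot,\xi,u)$ is the unique maximal solution with $x(s)=\xi(s)$ on $[-\theta,0]$ (locally absolutely continuous after time $0$ and satisfying the equation a.e.), $x_t^{\xi,u}$ its history segment, and $y(t,\xi,u)=h(x_t^{\xi,u})$. The system is forward complete if every maximal solution is defined for all $t\ge0$; it is robustly forward complete (RFC) if it is forward complete and for all $T,R>0$, $\sup\{\|x_t^{\xi,u}\|_{\mathcal X}: \|\xi\|_{\mathcal X}\le R,\ \|u\|\le R,\ t\in[0,T]\}<\infty$. IOS: forward complete and there are $\beta\in\mathcal{KL}$, $\gamma\in\mathcal N$ with $|y(t,\xi,u)|\le\beta(\|\xi\|_{\mathcal X},t)+\gamma(\|u\|)$ for all $t\ge0,\xi,u$. OL-IOS: IOS and additionally there is $\sigma\in\mathcal N$ with $|y(t,\xi,u)|\le\max\{\sigma(|h(\xi)|),\sigma(\|u\|)\}$ for all $t\ge0,\xi,u$ (with $h$ replaced by the relevant output map). An output redefinition of $h$ is a continuous map $\bar h:\mathcal X^n\to\mathbb R_{\ge0}$ for which there exist $\underline\alpha,\overline\alpha\in\mathcal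 K_\infty$ with $\underline\alpha(|h(\xi)|)\le|\bar h(\xi)|\le\overline\alpha(\|\xi\|_{\mathcal X})$ for all $\xi\in\mathcal X^n$. *)

theory Defs
  imports "HOL-Analysis.Analysis"
begin

definition classN :: "(real \<Rightarrow> real) \<Rightarrow> bool" where
  "classN \<sigma> \<longleftrightarrow> continuous_on {0..} \<sigma> \<and> mono_on {0..} \<sigma> \<and> \<sigma> 0 = 0
     \<and> (\<forall>s\<ge>0. \<sigma> s \<ge> 0)"

definition classK :: "(real \<Rightarrow> real) \<Rightarrow> bool" where
  "classK \<sigma> \<longleftrightarrow> classN \<sigma> \<and> strict_mono_on {0..} \<sigma>"

definition classKinf :: "(real \<Rightarrow> real) \<Rightarrow> bool" where
  "classKinf \<sigma> \<longleftrightarrow> classK \<sigma> \<and> (\<forall>r\<ge>0. \<exists>s\<ge>0. \<sigma> s = r)"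

definition classKL :: "(real \<Rightarrow> real \<Rightarrow> real) \<Rightarrow> bool" where
  "classKL \<beta> \<longleftrightarrow>
     (\<forall>t\<ge>0. classK (\<lambda>s. \<beta> s t)) \<and>
     (\<forall>s\<ge>0. antimono_on {0..} (\<beta> s) \<and> ((\<beta> s) \<longlongrightarrow> 0) at_top)"

text \<open>Elements of the state space are represented as functions on the reals that are
  continuous on [-\<theta>,0] and vanish outside [-\<theta>,0].\<close>

definition Xspace :: "real \<Rightarrow> (real \<Rightarrow> 'a::euclidean_space) set" where
  "Xspace \<theta> = {\<xi>. continuous_on {-\<theta>..0} \<xi> \<and> (\<forall>s. s \<notin> {-\<theta>..0} \<longrightarrow> \<xi> s = 0)}"

definition normX :: "real \<Rightarrow> (real \<Rightarrow> 'a::euclidean_space) \<Rightarrow> real" where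
  "normX \<theta> \<xi> = (SUP s\<in>{-\<theta>..0}. norm (\<xi> s))"

definition seg :: "real \<Rightarrow> (real \<Rightarrow> 'a::euclidean_space) \<Rightarrow> real \<Rightarrow> (real \<Rightarrow> 'a)" where
  "seg \<theta> x t = (\<lambda>s. if s \<in> {-\<theta>..0} then x (t + s) else 0)"

definition inputs :: "(real \<Rightarrow> 'b::euclidean_space) set" where
  "inputs = {u. set_borel_measurable lborel {0..} u \<and>
                (\<forall>T\<ge>0. \<exists>C. AE t in lborel. t \<in> {0..T} \<longrightarrow> norm (u t) \<le> C)}"

definition normU :: "(real \<Rightarrow> 'b::euclidean_space) \<Rightarrow> ereal" where
  "normU u = Inf {C::ereal. AE t in lborel. t \<ge> 0 \<longrightarrow> ereal (norm (u t)) \<le> C}"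

text \<open>Carath\'eodory solution on [-\<theta>,T]: initial history \<xi>, and x is given by the integral
  equation (equivalently: locally absolutely continuous on [0,T] and the ODE holds a.e.).\<close>
definition sol_on ::
  "real \<Rightarrow> ((real \<Rightarrow> 'a::euclidean_space) \<Rightarrow> 'b \<Rightarrow> 'a) \<Rightarrow> (real \<Rightarrow> 'a) \<Rightarrow> (real \<Rightarrow> 'b)
     \<Rightarrow> real \<Rightarrow> (real \<Rightarrow> 'a) \<Rightarrow> bool" where
  "sol_on \<theta> f \<xi> u T x \<longleftrightarrow>
     (\<forall>s\<in>{-\<theta>..0}. x s = \<xi> s) \<and>
     (\<lambda>s. f (seg \<theta> x s) (u s)) absolutely_integrable_on {0..T} \<and>
     (\<forall>t\<in>{0..T}. x t = \<xi> 0 + integral {0..t} (\<lambda>s. f (seg \<theta> x s) (u s)))"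

definition sol_upto ::
  "real \<Rightarrow> ((real \<Rightarrow> 'a::euclidean_space) \<Rightarrow> 'b \<Rightarrow> 'a) \<Rightarrow> (real \<Rightarrow> 'a) \<Rightarrow> (real \<Rightarrow> 'b)
     \<Rightarrow> ereal \<Rightarrow> (real \<Rightarrow> 'a) \<Rightarrow> bool" where
  "sol_upto \<theta> f \<xi> u b x \<longleftrightarrow> b > 0 \<and> (\<forall>T. 0 < T \<and> ereal T < b \<longrightarrow> sol_on \<theta> f \<xi> u T x)"

definition maximal_sol ::
  "real \<Rightarrow> ((real \<Rightarrow> 'a::euclidean_space) \<Rightarrow> 'b \<Rightarrow> 'a) \<Rightarrow> (real \<Rightarrow> 'a) \<Rightarrow> (real \<Rightarrow> 'b)
     \<Rightarrow> ereal \<Rightarrow> (real \<Rightarrow> 'a) \<Rightarrow> bool" where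
  "maximal_sol \<theta> f \<xi> u b x \<longleftrightarrow> sol_upto \<theta> f \<xi> u b x \<and>
     \<not> (\<exists>b' x'. b' > b \<and> sol_upto \<theta> f \<xi> u b' x' \<and>
                (\<forall>t. -\<theta> \<le> t \<and> ereal t < b \<longrightarrow> x' t = x t))"

definition forward_complete ::
  "real \<Rightarrow> ((real \<Rightarrow> 'a::euclidean_space) \<Rightarrow> 'b::euclidean_space \<Rightarrow> 'a) \<Rightarrow> bool" where
  "forward_complete \<theta> f \<longleftrightarrow>
     (\<forall>\<xi>\<in>Xspace \<theta>. \<forall>u\<in>inputs. \<forall>b x. maximal_sol \<theta> f \<xi> u b x \<longrightarrow> b = \<infinity>)"

definition RFC ::
  "real \<Rightarrow> ((real \<Rightarrow> 'a::euclidean_space) \<Rightarrow> 'b::euclidean_space \<Rightarrow> 'a) \<Rightarrow> bool" where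
  "RFC \<theta> f \<longleftrightarrow> forward_complete \<theta> f \<and>
     (\<forall>T>0. \<forall>R>0. \<exists>C. \<forall>\<xi>\<in>Xspace \<theta>. \<forall>u\<in>inputs. \<forall>x.
        normX \<theta> \<xi> \<le> R \<and> normU u \<le> ereal R \<and> sol_upto \<theta> f \<xi> u \<infinity> x \<longrightarrow>
        (\<forall>t\<in>{0..T}. normX \<theta> (seg \<theta> x t) \<le> C))"

text \<open>Estimates are required for inputs of finite norm (for \<parallel>u\<parallel> = \<infinity> they hold trivially).\<close>
definition IOS ::
  "real \<Rightarrow> ((real \<Rightarrow> 'a::euclidean_space) \<Rightarrow> 'b::euclidean_space \<Rightarrow> 'a)
     \<Rightarrow> ((real \<Rightarrow> 'a) \<Rightarrow> 'c::real_normed_vector) \<Rightarrow> bool" where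
  "IOS \<theta> f k \<longleftrightarrow> forward_complete \<theta> f \<and>
     (\<exists>\<beta> \<gamma>. classKL \<beta> \<and> classN \<gamma> \<and>
        (\<forall>\<xi>\<in>Xspace \<theta>. \<forall>u\<in>inputs. \<forall>x. sol_upto \<theta> f \<xi> u \<infinity> x \<and> normU u < \<infinity> \<longrightarrow>
           (\<forall>t\<ge>0. norm (k (seg \<theta> x t)) \<le> \<beta> (normX \<theta> \<xi>) t + \<gamma> (real_of_ereal (normU u)))))"

definition OL_IOS ::
  "real \<Rightarrow> ((real \<Rightarrow> 'a::euclidean_space) \<Rightarrow> 'b::euclidean_space \<Rightarrow> 'a)
     \<Rightarrow> ((real \<Rightarrow> 'a) \<Rightarrow> 'c::real_normed_vector) \<Rightarrow> bool" where
  "OL_IOS \<theta> f k \<longleftrightarrow> IOS \<theta> f k \<and>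
     (\<exists>\<sigma>. classN \<sigma> \<and>
        (\<forall>\<xi>\<in>Xspace \<theta>. \<forall>u\<in>inputs. \<forall>x. sol_upto \<theta> f \<xi> u \<infinity> x \<and> normU u < \<infinity> \<longrightarrow>
           (\<forall>t\<ge>0. norm (k (seg \<theta> x t)) \<le>
                   max (\<sigma> (norm (k \<xi>))) (\<sigma> (real_of_ereal (normU u))))))"

definition locally_lipschitz_f ::
  "real \<Rightarrow> ((real \<Rightarrow> 'a::euclidean_space) \<Rightarrow> 'b::euclidean_space \<Rightarrow> 'a) \<Rightarrow> bool" where
  "locally_lipschitz_f \<theta> f \<longleftrightarrow>
     (\<forall>\<xi>\<in>Xspace \<theta>. \<forall>v. \<exists>\<delta>>0. \<exists>L. \<forall>\<xi>1\<in>Xspace \<theta>. \<forall>\<xi>2\<in>Xspace \<theta>. \<forall>v1 v2.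
        normX \<theta> (\<xi>1 - \<xi>) < \<delta> \<and> normX \<theta> (\<xi>2 - \<xi>) < \<delta> \<and> norm (v1 - v) < \<delta> \<and> norm (v2 - v) < \<delta>
        \<longrightarrow> norm (f \<xi>1 v1 - f \<xi>2 v2) \<le> L * (normX \<theta> (\<xi>1 - \<xi>2) + norm (v1 - v2)))"

definition bounded_on_bounded ::
  "real \<Rightarrow> ((real \<Rightarrow> 'a::euclidean_space) \<Rightarrow> 'b::euclidean_space \<Rightarrow> 'a) \<Rightarrow> bool" where
  "bounded_on_bounded \<theta> f \<longleftrightarrow>
     (\<forall>R. \<exists>C. \<forall>\<xi>\<in>Xspace \<theta>. \<forall>v. normX \<theta> \<xi> \<le> R \<and> norm v \<le> R \<longrightarrow> norm (f \<xi> v) \<le> C)"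

definition continuous_X ::
  "real \<Rightarrow> ((real \<Rightarrow> 'a::euclidean_space) \<Rightarrow> 'c::real_normed_vector) \<Rightarrow> bool" where
  "continuous_X \<theta> k \<longleftrightarrow>
     (\<forall>\<xi>\<in>Xspace \<theta>. \<forall>\<epsilon>>0. \<exists>\<delta>>0. \<forall>\<eta>\<in>Xspace \<theta>. normX \<theta> (\<eta> - \<xi>) < \<delta> \<longrightarrow> norm (k \<eta> - k \<xi>) < \<epsilon>)"

definition locally_lipschitz_X ::
  "real \<Rightarrow> (real \<Rightarrow> 'a::euclidean_space) set \<Rightarrow> ((real \<Rightarrow> 'a) \<Rightarrow> 'c::real_normed_vector) \<Rightarrow> bool" where
  "locally_lipschitz_X \<theta> U k \<longleftrightarrow>
     (\<forall>\<xi>\<in>U. \<exists>\<delta>>0. \<exists>L. \<forall>\<eta>1\<in>U. \<forall>\<eta>2\<in>U.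
        normX \<theta> (\<eta>1 - \<xi>) < \<delta> \<and> normX \<theta> (\<eta>2 - \<xi>) < \<delta> \<longrightarrow>
        norm (k \<eta>1 - k \<eta>2) \<le> L * normX \<theta> (\<eta>1 - \<eta>2))"

definition output_redef ::
  "real \<Rightarrow> ((real \<Rightarrow> 'a::euclidean_space) \<Rightarrow> 'c::real_normed_vector) \<Rightarrow> ((real \<Rightarrow> 'a) \<Rightarrow> real) \<Rightarrow> bool" where
  "output_redef \<theta> h hb \<longleftrightarrow> continuous_X \<theta> hb \<and> (\<forall>\<xi>\<in>Xspace \<theta>. hb \<xi> \<ge> 0) \<and>
     (\<exists>\<alpha>l \<alpha>u. classKinf \<alpha>l \<and> classKinf \<alpha>u \<and>
        (\<forall>\<xi>\<in>Xspace \<theta>. \<alpha>l (norm (h \<xi>)) \<le> \<bar>hb \<xi>\<bar> \<and> \<bar>hb \<xi>\<bar> \<le> \<alpha>u (normX \<theta> \<xi>)))"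

end

theory Submission
  imports Defs "HOL-Complex_Analysis.Great_Picard"
begin

text \<open>The redefined output is
  \<open>V(\<xi>) = sup max(0, |h(x\<^sub>t)| - \<gamma>(r) - r)\<close>, taken over \<open>t \<ge> 0\<close>, \<open>r \<ge> 0\<close> and all trajectories \<open>x\<close>
  from \<open>\<xi>\<close> with input bounded by \<open>r\<close>. Restarting a trajectory at time \<open>t\<close> amounts to
  concatenating inputs, so \<open>V\<close> exceeds its initial value along a solution by at most the gain of the
  input, and it inherits the IOS estimate. Near a fixed \<open>\<xi>\<close> only bounded inputs and a bounded time
  horizon contribute to values of \<open>V\<close> above a positive threshold. There the solutions from \<open>\<xi>\<close> are
  bounded (RFC) and equicontinuous, so their segments form a precompact set by Arzela--Ascoli, near
  which \<open>f\<close> is Lipschitz and \<open>h\<close> uniformly continuous (or Lipschitz) uniformly in the input;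
  Gronwall's inequality then yields continuity (or the Lipschitz property) of \<open>V\<close>.
  Existence of solutions for every bounded input, needed to compare nearby initial states, comes from
  a local contraction argument together with forward completeness.\<close>

section \<open>The history space\<close>

text \<open>Bounded sets of the history space are not precompact, and a locally Lipschitz
  \<open>f\<close> may have no common Lipschitz constant on them, so bounds on trajectories alone do
  not allow them to be compared. Compactness is recovered by fixing the initial history: the
  trajectories from it have a common modulus of continuity, made of its own modulus and a bound on
  \<open>f\<close>, for all inputs of a given size at once. Inputs of every size enter the supremum,
  and subtracting the gain keeps it finite. The time horizon that decides the value of
  \<open>V\<close> depends on a positive threshold and may grow without bound as the threshold tends
  to 0. Continuity does not suffer, since values below the threshold are small anyway, but control
  of the Lipschitz constant is lost at the zeros of \<open>V\<close>. In the opposite direction, the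
  estimate for the redefined output is pulled back through an inverse of its lower comparison
  function.\<close>

lemma Xspace_diff: "\<xi> \<in> Xspace \<theta> \<Longrightarrow> \<eta> \<in> Xspace \<theta> \<Longrightarrow> \<xi> - \<eta> \<in> Xspace \<theta>"
  by (auto simp: Xspace_def fun_diff_def intro: continuous_intros)

lemma norm_le_normX:
  assumes "\<xi> \<in> Xspace \<theta>" "s \<in> {-\<theta>..0}"
  shows "norm (\<xi> s) \<le> normX \<theta> \<xi>"
proof -
  have "compact ((\<lambda>s. norm (\<xi> s)) ` {-\<theta>..0})"
    using assms by (intro compact_continuous_image continuous_intros) (auto simp: Xspace_def)
  then have "bdd_above ((\<lambda>s. norm (\<xi> s)) ` {-\<theta>..0})"
    by (simp add: bounded_imp_bdd_above compact_imp_bounded)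
  then show ?thesis
    unfolding normX_def using assms(2) by (intro cSUP_upper)
qed

lemma normX_le:
  assumes "\<theta> \<ge> 0" "\<And>s. s \<in> {-\<theta>..0} \<Longrightarrow> norm (\<xi> s) \<le> c"
  shows "normX \<theta> \<xi> \<le> c"
  unfolding normX_def using assms by (intro cSUP_least) auto

lemma normX_nonneg:
  assumes "\<theta> \<ge> 0" "\<xi> \<in> Xspace \<theta>"
  shows "normX \<theta> \<xi> \<ge> 0"
  using norm_le_normX[OF assms(2), of 0] assms(1) norm_ge_zero[of "\<xi> 0"]
  by (meson atLeastAtMost_iff neg_le_0_iff_le order_refl order_trans)

lemma normX_diff_self: "\<theta> \<ge> 0 \<Longrightarrow> normX \<theta> (\<xi> - \<xi>) = 0"
  by (simp add: normX_def)

lemma normX_commute: "normX \<theta> (\<xi> - \<eta>) = normX \<theta> (\<eta> - \<xi>)"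
  by (simp add: normX_def norm_minus_commute)

lemma normX_triangle:
  assumes "\<theta> \<ge> 0" "\<xi> \<in> Xspace \<theta>" "\<eta> \<in> Xspace \<theta>" "\<zeta> \<in> Xspace \<theta>"
  shows "normX \<theta> (\<xi> - \<zeta>) \<le> normX \<theta> (\<xi> - \<eta>) + normX \<theta> (\<eta> - \<zeta>)"
proof (rule normX_le)
  fix s assume s: "s \<in> {-\<theta>..0}"
  have "norm ((\<xi> - \<zeta>) s) \<le> norm ((\<xi> - \<eta>) s) + norm ((\<eta> - \<zeta>) s)"
    using norm_triangle_ineq[of "(\<xi> - \<eta>) s" "(\<eta> - \<zeta>) s"] by simp
  then show "norm ((\<xi> - \<zeta>) s) \<le> normX \<theta> (\<xi> - \<eta>) + normX \<theta> (\<eta> - \<zeta>)"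
    using norm_le_normX[OF Xspace_diff s] assms by (meson add_mono order_trans)
qed (use assms in auto)

lemma normX_le_add:
  assumes "\<theta> \<ge> 0" "\<xi> \<in> Xspace \<theta>" "\<eta> \<in> Xspace \<theta>"
  shows "normX \<theta> \<xi> \<le> normX \<theta> (\<xi> - \<eta>) + normX \<theta> \<eta>"
proof -
  have "(\<lambda>s. 0) \<in> Xspace \<theta>" by (auto simp: Xspace_def)
  from normX_triangle[OF assms this] show ?thesis
    by (simp add: fun_diff_def)
qed

lemma seg_in_Xspace:
  assumes "continuous_on {-\<theta>..T} x" "t \<in> {0..T}"
  shows "seg \<theta> x t \<in> Xspace \<theta>"
proof -
  have "continuous_on {-\<theta>..0} (\<lambda>s. x (t + s))"
    using assms(2) by (intro continuous_on_compose2[OF assms(1)] continuous_intros) auto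
  then have "continuous_on {-\<theta>..0} (seg \<theta> x t)"
    by (rule continuous_on_eq) (simp add: seg_def)
  then show ?thesis
    by (auto simp: Xspace_def seg_def)
qed

lemma seg_apply: "s \<in> {-\<theta>..0} \<Longrightarrow> seg \<theta> x t s = x (t + s)"
  by (simp add: seg_def)

lemma seg_cong:
  assumes "\<And>s. s \<in> {t - \<theta>..t} \<Longrightarrow> x s = y s"
  shows "seg \<theta> x t = seg \<theta> y t"
  using assms by (auto simp: seg_def fun_eq_iff)

lemma seg_0:
  assumes "\<xi> \<in> Xspace \<theta>" "\<And>s. s \<in> {-\<theta>..0} \<Longrightarrow> x s = \<xi> s"
  shows "seg \<theta> x 0 = \<xi>"
  using assms by (auto simp: seg_def Xspace_def fun_eq_iff)

section \<open>Precompact sets of histories\<close>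

text \<open>The limit is sought in \<open>Xspace \<theta>\<close> and not in \<open>K\<close>, so
  the sets of segments used below never have to be shown closed.\<close>

definition precompactX :: "real \<Rightarrow> (real \<Rightarrow> 'a::euclidean_space) set \<Rightarrow> bool" where
  "precompactX \<theta> K \<longleftrightarrow> (\<forall>\<kappa>::nat \<Rightarrow> real \<Rightarrow> 'a. range \<kappa> \<subseteq> K \<longrightarrow>
     (\<exists>\<xi>\<in>Xspace \<theta>. \<exists>r. strict_mono r \<and> (\<lambda>n. normX \<theta> (\<kappa> (r n) - \<xi>)) \<longlonglongrightarrow> 0))"

lemma precompactX_singleton:
  assumes "\<theta> \<ge> 0" "\<xi> \<in> Xspace \<theta>"
  shows "precompactX \<theta> {\<xi>}"
  unfolding precompactX_def
proof (intro allI impI bexI exI conjI)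
  fix \<kappa> :: "nat \<Rightarrow> _" assume "range \<kappa> \<subseteq> {\<xi>}"
  then have "\<And>n. \<kappa> n = \<xi>" by auto
  then show "(\<lambda>n. normX \<theta> (\<kappa> (id n) - \<xi>)) \<longlonglongrightarrow> 0"
    using normX_diff_self[OF assms(1), of \<xi>] by simp
qed (auto simp: assms strict_mono_def)

text \<open>A segment is a translate of its function and inherits the bound \<open>B\<close> and the
  modulus of continuity. Both are uniform in the function and in \<open>t\<close>, so Arzela-Ascoli
  applies on the fixed interval \<open>{-\<theta>..0}\<close>.\<close>

lemma precompactX_segments:
  fixes \<Phi> :: "(real \<Rightarrow> 'a::euclidean_space) set"
  assumes "\<theta> > 0"
    and bnd: "\<And>\<phi> s. \<phi> \<in> \<Phi> \<Longrightarrow> s \<in> {-\<theta>..T} \<Longrightarrow> norm (\<phi> s) \<le> B"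
    and equi: "\<And>e. e > 0 \<Longrightarrow> \<exists>d>0. \<forall>\<phi>\<in>\<Phi>. \<forall>a\<in>{-\<theta>..T}. \<forall>b\<in>{-\<theta>..T}. \<bar>a - b\<bar> < d \<longrightarrow> norm (\<phi> a - \<phi> b) < e"
  shows "precompactX \<theta> {seg \<theta> \<phi> t |\<phi> t. \<phi> \<in> \<Phi> \<and> t \<in> {0..T}}"
  unfolding precompactX_def
proof (intro allI impI)
  fix \<kappa> :: "nat \<Rightarrow> real \<Rightarrow> 'a"
  assume "range \<kappa> \<subseteq> {seg \<theta> \<phi> t |\<phi> t. \<phi> \<in> \<Phi> \<and> t \<in> {0..T}}"
  then have "\<forall>n. \<exists>\<phi> t. \<kappa> n = seg \<theta> \<phi> t \<and> \<phi> \<in> \<Phi> \<and> t \<in> {0..T}" by blast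
  then obtain \<phi> t where \<kappa>: "\<And>n. \<kappa> n = seg \<theta> (\<phi> n) (t n)" "\<And>n. \<phi> n \<in> \<Phi>" "\<And>n. t n \<in> {0..T}"
    by metis
  have 1: "norm (\<kappa> n s) \<le> B" if "s \<in> {-\<theta>..0}" for n s
    using bnd[OF \<kappa>(2), of "t n + s" n] \<kappa>(3)[of n] that by (simp add: \<kappa>(1) seg_def)
  have 2: "\<exists>d>0. \<forall>n y. y \<in> {-\<theta>..0} \<and> norm (s - y) < d \<longrightarrow> norm (\<kappa> n s - \<kappa> n y) < e"
    if s: "s \<in> {-\<theta>..0}" and e: "e > 0" for s e
  proof -
    obtain d where d: "d > 0"
      "\<forall>\<phi>\<in>\<Phi>. \<forall>a\<in>{-\<theta>..T}. \<forall>b\<in>{-\<theta>..T}. \<bar>a - b\<bar> < d \<longrightarrow> norm (\<phi> a - \<phi> b) < e"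
      using equi[OF e] by blast
    have "norm (\<kappa> n s - \<kappa> n y) < e" if y: "y \<in> {-\<theta>..0} \<and> norm (s - y) < d" for n y
      using d(2)[rule_format, OF \<kappa>(2), of "t n + s" "t n + y" n] \<kappa>(3)[of n] s y
      by (simp add: \<kappa>(1) seg_def)
    with d(1) show ?thesis by blast
  qed
  obtain g k where g: "continuous_on {-\<theta>..0} g" "strict_mono (k :: nat \<Rightarrow> nat)"
    "\<And>e. 0 < e \<Longrightarrow> \<exists>N. \<forall>n x. n \<ge> N \<and> x \<in> {-\<theta>..0} \<longrightarrow> norm (\<kappa> (k n) x - g x) < e"
    using Arzela_Ascoli[of "{-\<theta>..0}" \<kappa> B] 1 2 by (metis compact_Icc)
  \<comment> \<open>Arzela-Ascoli determines \<open>g\<close> on the interval only, whereas elements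
    of \<open>Xspace\<close> vanish outside it.\<close>
  define \<xi> where "\<xi> = (\<lambda>s. if s \<in> {-\<theta>..0} then g s else 0)"
  have "continuous_on {-\<theta>..0} \<xi>"
    using g(1) by (rule continuous_on_eq) (simp add: \<xi>_def)
  then have "\<xi> \<in> Xspace \<theta>"
    by (auto simp: Xspace_def \<xi>_def)
  moreover have "(\<lambda>n. normX \<theta> (\<kappa> (k n) - \<xi>)) \<longlonglongrightarrow> 0"
  proof (rule LIMSEQ_I)
    fix e :: real assume "e > 0"
    then obtain N where N: "\<forall>n x. n \<ge> N \<and> x \<in> {-\<theta>..0} \<longrightarrow> norm (\<kappa> (k n) x - g x) < e / 2"
      using g(3)[of "e / 2"] by auto
    have "norm (normX \<theta> (\<kappa> (k n) - \<xi>) - 0) < e" if "n \<ge> N" for n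
    proof -
      have "normX \<theta> (\<kappa> (k n) - \<xi>) \<le> e / 2"
        using N that \<open>\<theta> > 0\<close> by (intro normX_le) (auto simp: \<xi>_def less_imp_le)
      moreover have "0 \<le> norm ((\<kappa> (k n) - \<xi>) 0)" by simp
      moreover have "norm ((\<kappa> (k n) - \<xi>) 0) \<le> normX \<theta> (\<kappa> (k n) - \<xi>)"
        unfolding normX_def
        using N that \<open>\<theta> > 0\<close> by (intro cSUP_upper bdd_aboveI2[where M = "e / 2"]) (auto simp: \<xi>_def less_imp_le)
      ultimately show ?thesis unfolding real_norm_def using \<open>e > 0\<close> by linarith
    qed
    then show "\<exists>N. \<forall>n\<ge>N. norm (normX \<theta> (\<kappa> (k n) - \<xi>) - 0) < e" by blast
  qed
  ultimately show "\<exists>\<xi>\<in>Xspace \<theta>. \<exists>r. strict_mono r \<and> (\<lambda>n. normX \<theta> (\<kappa> (r n) - \<xi>)) \<longlonglongrightarrow> 0"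
    using g(2) by blast
qed

section \<open>Uniform estimates near precompact sets\<close>

text \<open>Violations with radius \<open>1 / real (Suc n)\<close> and constant
  \<open>real (Suc n)\<close> would accumulate at a history \<open>\<xi>\<close> and, closed balls
  of inputs being compact, at an input \<open>v\<close>, against the local estimate there. The two
  compared histories share the input \<open>w\<close>, so a map of the history alone is covered by
  giving it a dummy input.\<close>

lemma uniformly_lipschitz_near_precompact:
  fixes g :: "(real \<Rightarrow> 'a::euclidean_space) \<Rightarrow> 'b::euclidean_space \<Rightarrow> 'c::real_normed_vector"
  assumes "\<theta> \<ge> 0" and K: "K \<subseteq> Xspace \<theta>" "precompactX \<theta> K"
    and lip: "\<And>\<xi> v. \<xi> \<in> Xspace \<theta> \<Longrightarrow> \<exists>\<delta>>0. \<exists>L. \<forall>\<xi>1\<in>Xspace \<theta>. \<forall>\<xi>2\<in>Xspace \<theta>. \<forall>w.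
      normX \<theta> (\<xi>1 - \<xi>) < \<delta> \<and> normX \<theta> (\<xi>2 - \<xi>) < \<delta> \<and> norm (w - v) < \<delta>
      \<longrightarrow> norm (g \<xi>1 w - g \<xi>2 w) \<le> L * normX \<theta> (\<xi>1 - \<xi>2)"
  obtains \<delta> L where "\<delta> > 0" "L > 0"
    "\<And>\<kappa> \<xi>1 \<xi>2 w. \<kappa> \<in> K \<Longrightarrow> \<xi>1 \<in> Xspace \<theta> \<Longrightarrow> \<xi>2 \<in> Xspace \<theta> \<Longrightarrow> normX \<theta> (\<xi>1 - \<kappa>) < \<delta>
      \<Longrightarrow> normX \<theta> (\<xi>2 - \<kappa>) < \<delta> \<Longrightarrow> norm w \<le> r \<Longrightarrow> norm (g \<xi>1 w - g \<xi>2 w) \<le> L * normX \<theta> (\<xi>1 - \<xi>2)"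
proof -
  define P where "P n \<kappa> \<xi>1 \<xi>2 w \<longleftrightarrow> \<kappa> \<in> K \<and> \<xi>1 \<in> Xspace \<theta> \<and> \<xi>2 \<in> Xspace \<theta> \<and>
    normX \<theta> (\<xi>1 - \<kappa>) < 1 / real (Suc n) \<and> normX \<theta> (\<xi>2 - \<kappa>) < 1 / real (Suc n) \<and> norm w \<le> r \<and>
    \<not> norm (g \<xi>1 w - g \<xi>2 w) \<le> real (Suc n) * normX \<theta> (\<xi>1 - \<xi>2)" for n \<kappa> \<xi>1 \<xi>2 w
  have "\<exists>n. \<nexists>\<kappa> \<xi>1 \<xi>2 w. P n \<kappa> \<xi>1 \<xi>2 w"
  proof (rule ccontr)
    assume "\<not> ?thesis"
    then have "\<forall>n. \<exists>\<kappa> \<xi>1 \<xi>2 w. P n \<kappa> \<xi>1 \<xi>2 w" by blast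
    then obtain \<kappa> \<xi>1 \<xi>2 w where P: "\<And>n. P n (\<kappa> n) (\<xi>1 n) (\<xi>2 n) (w n)" by metis
    then have \<kappa>K: "\<And>n. \<kappa> n \<in> Xspace \<theta>" using K(1) by (auto simp: P_def)
    have "range \<kappa> \<subseteq> K" using P by (auto simp: P_def)
    then obtain \<xi> q where \<xi>: "\<xi> \<in> Xspace \<theta>" "strict_mono q" "(\<lambda>n. normX \<theta> (\<kappa> (q n) - \<xi>)) \<longlonglongrightarrow> 0"
      using K(2) unfolding precompactX_def by metis
    have "\<forall>n. (w \<circ> q) n \<in> cball 0 r" using P by (auto simp: P_def)
    then obtain v p where v: "strict_mono p" "(w \<circ> q \<circ> p) \<longlonglongrightarrow> v"
      using compact_cball[of "0 :: 'b" r] unfolding compact_def by metis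
    \<comment> \<open>A common subsequence along which both the centres \<open>\<kappa>\<close> and
      the inputs \<open>w\<close> converge.\<close>
    define m where "m = q \<circ> p"
    have m: "strict_mono m" unfolding m_def using \<xi>(2) v(1) by (rule strict_mono_o)
    have \<kappa>m: "(\<lambda>n. normX \<theta> (\<kappa> (m n) - \<xi>)) \<longlonglongrightarrow> 0"
      using LIMSEQ_subseq_LIMSEQ[OF \<xi>(3) v(1)] by (simp add: m_def o_def)
    have wm: "(\<lambda>n. w (m n)) \<longlonglongrightarrow> v" using v(2) by (simp add: m_def o_def)
    obtain \<delta> L where \<delta>: "\<delta> > 0" and L: "\<forall>\<xi>1\<in>Xspace \<theta>. \<forall>\<xi>2\<in>Xspace \<theta>. \<forall>w.
      normX \<theta> (\<xi>1 - \<xi>) < \<delta> \<and> normX \<theta> (\<xi>2 - \<xi>) < \<delta> \<and> norm (w - v) < \<delta>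
      \<longrightarrow> norm (g \<xi>1 w - g \<xi>2 w) \<le> L * normX \<theta> (\<xi>1 - \<xi>2)"
      using lip[OF \<xi>(1), of v] by blast
    have "(\<lambda>n. normX \<theta> (\<kappa> (m n) - \<xi>) + 1 / real (Suc (m n))) \<longlonglongrightarrow> 0 + 0"
      using LIMSEQ_subseq_LIMSEQ[OF lim_1_over_n[THEN LIMSEQ_Suc] m, unfolded o_def]
      by (intro tendsto_add \<kappa>m) auto
    then have "\<forall>\<^sub>F n in sequentially. normX \<theta> (\<kappa> (m n) - \<xi>) + 1 / real (Suc (m n)) < \<delta>"
      using \<delta> by (intro order_tendstoD(2)[of _ 0]) auto
    moreover have "\<forall>\<^sub>F n in sequentially. norm (w (m n) - v) < \<delta>"
      using tendstoD[OF wm \<delta>] by (simp add: dist_norm)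
    moreover have "\<forall>\<^sub>F n in sequentially. L \<le> real n"
      using filterlim_real_sequentially by (simp add: filterlim_at_top)
    ultimately have "\<forall>\<^sub>F n in sequentially. False"
    proof eventually_elim
      case (elim n)
      note Pn = P[of "m n", unfolded P_def]
      have "normX \<theta> (\<xi>1 (m n) - \<xi>) < \<delta>"
        using normX_triangle[OF \<open>\<theta> \<ge> 0\<close>, of "\<xi>1 (m n)" "\<kappa> (m n)" \<xi>] Pn \<kappa>K \<xi>(1) elim(1) by fastforce
      moreover have "normX \<theta> (\<xi>2 (m n) - \<xi>) < \<delta>"
        using normX_triangle[OF \<open>\<theta> \<ge> 0\<close>, of "\<xi>2 (m n)" "\<kappa> (m n)" \<xi>] Pn \<kappa>K \<xi>(1) elim(1) by fastforce
      ultimately have "norm (g (\<xi>1 (m n)) (w (m n)) - g (\<xi>2 (m n)) (w (m n))) \<le> L * normX \<theta> (\<xi>1 (m n) - \<xi>2 (m n))"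
        using L Pn elim(2) by blast
      also have "\<dots> \<le> real (Suc (m n)) * normX \<theta> (\<xi>1 (m n) - \<xi>2 (m n))"
      proof (rule mult_right_mono)
        have "real n \<le> real (m n)" using strict_mono_imp_increasing[OF m, of n] by simp
        then show "L \<le> real (Suc (m n))" using elim(3) by simp
        show "0 \<le> normX \<theta> (\<xi>1 (m n) - \<xi>2 (m n))"
          using Pn by (intro normX_nonneg[OF \<open>\<theta> \<ge> 0\<close>] Xspace_diff) auto
      qed
      finally show False using Pn by blast
    qed
    then show False by simp
  qed
  then obtain n where "\<nexists>\<kappa> \<xi>1 \<xi>2 w. P n \<kappa> \<xi>1 \<xi>2 w" by blast
  then show ?thesis
    unfolding P_def by (intro that[of "1 / real (Suc n)" "real (Suc n)"]) (simp, simp, blast)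
qed

text \<open>The comparison is with the centre \<open>\<kappa>\<close> itself. This fits the
  continuity of \<open>V\<close>, where the centre is a segment of a trajectory from the reference
  history.\<close>

lemma uniformly_continuous_near_precompact:
  fixes h :: "(real \<Rightarrow> 'a::euclidean_space) \<Rightarrow> 'c::real_normed_vector"
  assumes "\<theta> \<ge> 0" and K: "K \<subseteq> Xspace \<theta>" "precompactX \<theta> K"
    and cont: "continuous_X \<theta> h" and e: "e > 0"
  obtains \<delta> where "\<delta> > 0"
    "\<And>\<kappa> \<eta>. \<kappa> \<in> K \<Longrightarrow> \<eta> \<in> Xspace \<theta> \<Longrightarrow> normX \<theta> (\<eta> - \<kappa>) < \<delta> \<Longrightarrow> norm (h \<eta> - h \<kappa>) < e"
proof -
  define P where "P n \<kappa> \<eta> \<longleftrightarrow> \<kappa> \<in> K \<and> \<eta> \<in> Xspace \<theta> \<and>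
    normX \<theta> (\<eta> - \<kappa>) < 1 / real (Suc n) \<and> \<not> norm (h \<eta> - h \<kappa>) < e" for n \<kappa> \<eta>
  have "\<exists>n. \<nexists>\<kappa> \<eta>. P n \<kappa> \<eta>"
  proof (rule ccontr)
    assume "\<not> ?thesis"
    then have "\<forall>n. \<exists>\<kappa> \<eta>. P n \<kappa> \<eta>" by blast
    then obtain \<kappa> \<eta> where P: "\<And>n. P n (\<kappa> n) (\<eta> n)" by metis
    then have \<kappa>K: "\<And>n. \<kappa> n \<in> Xspace \<theta>" using K(1) by (auto simp: P_def)
    have "range \<kappa> \<subseteq> K" using P by (auto simp: P_def)
    then obtain \<xi> m where \<xi>: "\<xi> \<in> Xspace \<theta>" and m: "strict_mono m" and
      \<kappa>m: "(\<lambda>n. normX \<theta> (\<kappa> (m n) - \<xi>)) \<longlonglongrightarrow> 0"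
      using K(2) unfolding precompactX_def by metis
    \<comment> \<open>Half of \<open>e\<close>, because both \<open>\<eta> (m n)\<close> and
      \<open>\<kappa> (m n)\<close> are compared with the limit \<open>\<xi>\<close>.\<close>
    obtain \<delta> where \<delta>: "\<delta> > 0" "\<forall>\<eta>\<in>Xspace \<theta>. normX \<theta> (\<eta> - \<xi>) < \<delta> \<longrightarrow> norm (h \<eta> - h \<xi>) < e / 2"
      using cont \<xi> e unfolding continuous_X_def by (meson half_gt_zero)
    have "(\<lambda>n. normX \<theta> (\<kappa> (m n) - \<xi>) + 1 / real (Suc (m n))) \<longlonglongrightarrow> 0 + 0"
      using LIMSEQ_subseq_LIMSEQ[OF lim_1_over_n[THEN LIMSEQ_Suc] m, unfolded o_def]
      by (intro tendsto_add \<kappa>m) auto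
    then have "\<forall>\<^sub>F n in sequentially. normX \<theta> (\<kappa> (m n) - \<xi>) + 1 / real (Suc (m n)) < \<delta>"
      using \<delta> by (intro order_tendstoD(2)[of _ 0]) auto
    then have "\<forall>\<^sub>F n in sequentially. False"
    proof eventually_elim
      case (elim n)
      note Pn = P[of "m n", unfolded P_def]
      have "normX \<theta> (\<eta> (m n) - \<xi>) < \<delta>"
        using normX_triangle[OF \<open>\<theta> \<ge> 0\<close>, of "\<eta> (m n)" "\<kappa> (m n)" \<xi>] Pn \<kappa>K \<xi> elim(1) by fastforce
      then have 1: "norm (h (\<eta> (m n)) - h \<xi>) < e / 2" using \<delta>(2) Pn by blast
      have "0 < 1 / real (Suc (m n))" by simp
      then have "normX \<theta> (\<kappa> (m n) - \<xi>) < \<delta>" using elim(1) by linarith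
      then have "norm (h (\<kappa> (m n)) - h \<xi>) < e / 2" using \<delta>(2) \<kappa>K by blast
      with 1 have "norm (h (\<eta> (m n)) - h (\<kappa> (m n))) < e"
        by (metis dist_norm dist_triangle_half_l)
      then show False using Pn by blast
    qed
    then show False by simp
  qed
  then obtain n where "\<nexists>\<kappa> \<eta>. P n \<kappa> \<eta>" by blast
  then show ?thesis
    unfolding P_def by (intro that[of "1 / real (Suc n)"]) (simp, blast)
qed

section \<open>Inputs\<close>

text \<open>Inputs bounded everywhere rather than almost everywhere: every input of finite norm
  agrees with such an input outside a null set, hence has the same solutions.\<close>

definition bounded_input :: "real \<Rightarrow> (real \<Rightarrow> 'b::euclidean_space) \<Rightarrow> bool" where
  "bounded_input r u \<longleftrightarrow> u \<in> borel_measurable borel \<and> (\<forall>t. norm (u t) \<le> r)"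

lemma bounded_input_mono: "bounded_input r u \<Longrightarrow> r \<le> r' \<Longrightarrow> bounded_input r' u"
  by (auto simp: bounded_input_def intro: order_trans)

lemma bounded_input_in_inputs:
  assumes "bounded_input r u"
  shows "u \<in> inputs" and "normU u \<le> ereal r"
proof -
  have [measurable]: "u \<in> borel_measurable borel" using assms by (simp add: bounded_input_def)
  have "set_borel_measurable lborel {0..} u"
    unfolding set_borel_measurable_def by measurable
  then show "u \<in> inputs"
    using assms by (auto simp: inputs_def bounded_input_def)
  show "normU u \<le> ereal r"
    unfolding normU_def by (rule Inf_lower) (use assms in \<open>auto simp: bounded_input_def\<close>)
qed

text \<open>The infimum in \<open>normU\<close> ranges over all of \<open>ereal\<close>, so negative
  essential bounds have to be excluded: one of them would make \<open>{0..1}\<close> a null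
  set.\<close>

lemma normU_nonneg: "normU u \<ge> 0"
  unfolding normU_def
proof (rule Inf_greatest, rule ccontr)
  fix C :: ereal assume C: "C \<in> {C. AE t in lborel. t \<ge> 0 \<longrightarrow> ereal (norm (u t)) \<le> C}" "\<not> 0 \<le> C"
  then have "AE t in lborel. t \<ge> 0 \<longrightarrow> ereal (norm (u t)) \<le> C" by simp
  then have "AE t in lborel. t \<notin> {0..1::real}"
  proof eventually_elim
    case (elim t)
    have "0 \<le> ereal (norm (u t))" by simp
    then show ?case using elim C(2) by (meson atLeastAtMost_iff order_trans)
  qed
  then have "emeasure lborel {0..1::real} = 0"
    by (subst (asm) AE_iff_measurable[where N = "{0..1}"]) auto
  then show False by simp
qed

text \<open>The infimum is attained: the exceptional sets for the bounds
  \<open>r + 1 / real (Suc n)\<close> are countably many null sets.\<close>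

lemma AE_le_normU:
  assumes "normU u = ereal r"
  shows "AE t in lborel. t \<ge> 0 \<longrightarrow> norm (u t) \<le> r"
proof -
  have "AE t in lborel. t \<ge> 0 \<longrightarrow> norm (u t) \<le> r + 1 / real (Suc n)" for n
  proof -
    have "normU u < ereal (r + 1 / real (Suc n))" using assms by simp
    then obtain C where C: "AE t in lborel. t \<ge> 0 \<longrightarrow> ereal (norm (u t)) \<le> C" "C < ereal (r + 1 / real (Suc n))"
      unfolding normU_def Inf_less_iff by blast
    show ?thesis using C(1)
    proof eventually_elim
      case (elim t)
      then show ?case using C(2) by (metis ereal_less_eq(3) less_imp_le order_trans)
    qed
  qed
  then have "AE t in lborel. \<forall>n. t \<ge> 0 \<longrightarrow> norm (u t) \<le> r + 1 / real (Suc n)"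
    by (subst AE_all_countable) blast
  then show ?thesis
  proof eventually_elim
    case (elim t)
    show ?case
    proof
      assume "t \<ge> 0"
      have "norm (u t) \<le> r + e" if "e > 0" for e
      proof -
        obtain n where "1 / real (Suc n) < e" using \<open>e > 0\<close> nat_approx_posE by blast
        then show ?thesis using elim[rule_format, of n] \<open>t \<ge> 0\<close> by linarith
      qed
      then show "norm (u t) \<le> r" by (rule field_le_epsilon)
    qed
  qed
qed

lemma bounded_input_representative:
  assumes u: "u \<in> inputs" and r: "normU u = ereal r"
  obtains u' N where "bounded_input r u'" "negligible N" "\<And>t. t \<ge> 0 \<Longrightarrow> t \<notin> N \<Longrightarrow> u' t = u t"
proof -
  \<comment> \<open>\<open>inputs\<close> gives measurability on \<open>{0..}\<close>; extension by
    0 yields a Borel function on the line. Values of norm above \<open>r\<close> are then replaced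
    by 0, which respects the bound because \<open>r\<close> is nonnegative.\<close>
  define g where "g t = indicator {0..} t *\<^sub>R u t" for t :: real
  define u' where "u' t = (if norm (g t) \<le> r then g t else 0)" for t
  have [measurable]: "g \<in> borel_measurable borel"
    using u by (simp add: g_def[abs_def] inputs_def set_borel_measurable_def)
  have "r \<ge> 0" using normU_nonneg[of u] r by simp
  moreover have "u' \<in> borel_measurable borel" unfolding u'_def by measurable
  ultimately have "bounded_input r u'" by (auto simp: bounded_input_def u'_def)
  moreover have "AE t in lebesgue. t \<ge> 0 \<longrightarrow> norm (u t) \<le> r"
    using AE_le_normU[OF r] by (rule AE_completion)
  then obtain N where "N \<in> null_sets lebesgue" "{t \<in> space lebesgue. \<not> (t \<ge> 0 \<longrightarrow> norm (u t) \<le> r)} \<subseteq> N"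
    unfolding eventually_ae_filter by blast
  moreover from this have "negligible N" by (simp add: negligible_iff_null_sets)
  moreover have "u' t = u t" if "t \<ge> 0" "t \<notin> N" for t
  proof -
    have "norm (u t) \<le> r" using that calculation by fastforce
    then show ?thesis using that by (simp add: u'_def g_def)
  qed
  ultimately show ?thesis using that by blast
qed

section \<open>Solutions of delay systems\<close>

locale delay_system =
  fixes \<theta> :: real
    and f :: "(real \<Rightarrow> 'a::euclidean_space) \<Rightarrow> 'b::euclidean_space \<Rightarrow> 'a"
  assumes delay_pos: "\<theta> > 0"
    and lipschitz_f: "locally_lipschitz_f \<theta> f"
    and bounded_f: "bounded_on_bounded \<theta> f"
begin

section \<open>Regularity of the right-hand side\<close>

lemma lipschitz_near_precompact:
  fixes K :: "(real \<Rightarrow> 'a) set"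
  assumes "K \<subseteq> Xspace \<theta>" "precompactX \<theta> K"
  obtains \<delta> L where "\<delta> > 0" "L > 0"
    "\<And>\<kappa> \<xi>1 \<xi>2 w. \<kappa> \<in> K \<Longrightarrow> \<xi>1 \<in> Xspace \<theta> \<Longrightarrow> \<xi>2 \<in> Xspace \<theta> \<Longrightarrow> normX \<theta> (\<xi>1 - \<kappa>) < \<delta>
      \<Longrightarrow> normX \<theta> (\<xi>2 - \<kappa>) < \<delta> \<Longrightarrow> norm w \<le> r \<Longrightarrow> norm (f \<xi>1 w - f \<xi>2 w) \<le> L * normX \<theta> (\<xi>1 - \<xi>2)"
proof (rule uniformly_lipschitz_near_precompact[OF _ assms, of f r])
  fix \<xi> :: "real \<Rightarrow> 'a" and v assume "\<xi> \<in> Xspace \<theta>"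
  then obtain \<delta> L where "\<delta> > 0" and L: "\<forall>\<xi>1\<in>Xspace \<theta>. \<forall>\<xi>2\<in>Xspace \<theta>. \<forall>v1 v2.
        normX \<theta> (\<xi>1 - \<xi>) < \<delta> \<and> normX \<theta> (\<xi>2 - \<xi>) < \<delta> \<and> norm (v1 - v) < \<delta> \<and> norm (v2 - v) < \<delta>
        \<longrightarrow> norm (f \<xi>1 v1 - f \<xi>2 v2) \<le> L * (normX \<theta> (\<xi>1 - \<xi>2) + norm (v1 - v2))"
    using lipschitz_f unfolding locally_lipschitz_f_def by blast
  have "norm (f \<xi>1 w - f \<xi>2 w) \<le> L * normX \<theta> (\<xi>1 - \<xi>2)"
    if "\<xi>1 \<in> Xspace \<theta>" "\<xi>2 \<in> Xspace \<theta>" "normX \<theta> (\<xi>1 - \<xi>) < \<delta> \<and> normX \<theta> (\<xi>2 - \<xi>) < \<delta> \<and> norm (w - v) < \<delta>"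
    for \<xi>1 \<xi>2 w
    using L[rule_format, of \<xi>1 \<xi>2 w w] that by simp
  with \<open>\<delta> > 0\<close> show "\<exists>\<delta>>0. \<exists>L. \<forall>\<xi>1\<in>Xspace \<theta>. \<forall>\<xi>2\<in>Xspace \<theta>. \<forall>w.
      normX \<theta> (\<xi>1 - \<xi>) < \<delta> \<and> normX \<theta> (\<xi>2 - \<xi>) < \<delta> \<and> norm (w - v) < \<delta>
      \<longrightarrow> norm (f \<xi>1 w - f \<xi>2 w) \<le> L * normX \<theta> (\<xi>1 - \<xi>2)" by blast
qed (use delay_pos that in auto)

lemma continuous_in_state_and_input:
  assumes \<xi>: "\<xi> \<in> Xspace \<theta>" and "e > 0"
  shows "\<exists>d>0. \<forall>\<eta>\<in>Xspace \<theta>. \<forall>w. normX \<theta> (\<eta> - \<xi>) < d \<and> norm (w - v) < d \<longrightarrow> norm (f \<eta> w - f \<xi> v) < e"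
proof -
  obtain \<delta> L where \<delta>: "\<delta> > 0" and L: "\<forall>\<xi>1\<in>Xspace \<theta>. \<forall>\<xi>2\<in>Xspace \<theta>. \<forall>v1 v2.
        normX \<theta> (\<xi>1 - \<xi>) < \<delta> \<and> normX \<theta> (\<xi>2 - \<xi>) < \<delta> \<and> norm (v1 - v) < \<delta> \<and> norm (v2 - v) < \<delta>
        \<longrightarrow> norm (f \<xi>1 v1 - f \<xi>2 v2) \<le> L * (normX \<theta> (\<xi>1 - \<xi>2) + norm (v1 - v2))"
    using lipschitz_f \<xi> unfolding locally_lipschitz_f_def by blast
  \<comment> \<open>\<open>L\<close> may be negative or zero, hence
    \<open>\<bar>L\<bar> + 1\<close>; each of the two distances contributes less than
    \<open>e / 2\<close>.\<close>
  define d where "d = min \<delta> (e / (2 * (\<bar>L\<bar> + 1)))"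
  have "d > 0" using \<delta> \<open>e > 0\<close> by (simp add: d_def)
  moreover have "norm (f \<eta> w - f \<xi> v) < e"
    if \<eta>: "\<eta> \<in> Xspace \<theta>" "normX \<theta> (\<eta> - \<xi>) < d \<and> norm (w - v) < d" for \<eta> w
  proof -
    have nn: "0 \<le> normX \<theta> (\<eta> - \<xi>)" using delay_pos \<eta> \<xi> by (simp add: normX_nonneg Xspace_diff)
    have "norm (f \<eta> w - f \<xi> v) \<le> L * (normX \<theta> (\<eta> - \<xi>) + norm (w - v))"
      using L[rule_format, of \<eta> \<xi> w v] \<eta> \<xi> \<delta> delay_pos normX_diff_self[of \<theta> \<xi>]
      by (simp add: d_def)
    also have "\<dots> \<le> (\<bar>L\<bar> + 1) * (normX \<theta> (\<eta> - \<xi>) + norm (w - v))"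
      using nn by (intro mult_right_mono) auto
    also have "\<dots> < (\<bar>L\<bar> + 1) * (e / (2 * (\<bar>L\<bar> + 1)) + e / (2 * (\<bar>L\<bar> + 1)))"
      using \<eta> by (intro mult_strict_left_mono add_strict_mono) (auto simp: d_def)
    also have "\<dots> = e"
    proof -
      have "k * (e / (2 * k) + e / (2 * k)) = e" if "k > 0" for k :: real
        using that by (simp add: field_simps)
      from this[of "\<bar>L\<bar> + 1"] show ?thesis by linarith
    qed
    finally show ?thesis .
  qed
  ultimately show ?thesis by blast
qed

lemma continuous_in_input:
  assumes "\<xi> \<in> Xspace \<theta>"
  shows "continuous_on UNIV (f \<xi>)"
  unfolding continuous_on_iff
proof (intro ballI allI impI)
  fix v :: 'b and e :: real assume "e > 0"
  then obtain d where "d > 0" "\<forall>\<eta>\<in>Xspace \<theta>. \<forall>w. normX \<theta> (\<eta> - \<xi>) < d \<and> norm (w - v) < d \<longrightarrow> norm (f \<eta> w - f \<xi> v) < e"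
    using continuous_in_state_and_input[OF assms] by blast
  moreover have "normX \<theta> (\<xi> - \<xi>) = 0" using delay_pos by (simp add: normX_diff_self)
  ultimately show "\<exists>d>0. \<forall>w\<in>UNIV. dist w v < d \<longrightarrow> dist (f \<xi> w) (f \<xi> v) < e"
    using assms by (auto simp: dist_norm)
qed

lemma seg_continuous:
  assumes x: "continuous_on {-\<theta>..T} x" and t: "t \<in> {0..T}" and "e > 0"
  shows "\<exists>d>0. \<forall>s\<in>{0..T}. \<bar>s - t\<bar> < d \<longrightarrow> normX \<theta> (seg \<theta> x s - seg \<theta> x t) < e"
proof -
  have "uniformly_continuous_on {-\<theta>..T} x"
    using x by (intro compact_uniformly_continuous) auto
  then obtain d where d: "d > 0" "\<And>a b. a \<in> {-\<theta>..T} \<Longrightarrow> b \<in> {-\<theta>..T} \<Longrightarrow> dist b a < d \<Longrightarrow> dist (x b) (x a) < e / 2"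
    unfolding uniformly_continuous_on_def using \<open>e > 0\<close> by (metis half_gt_zero)
  have "normX \<theta> (seg \<theta> x s - seg \<theta> x t) \<le> e / 2" if "s \<in> {0..T}" "\<bar>s - t\<bar> < d" for s
    using d(2)[of "t + _" "s + _"] that t delay_pos
    by (intro normX_le) (auto simp: seg_apply dist_norm less_imp_le)
  then show ?thesis using d(1) \<open>e > 0\<close> by (smt (verit) field_sum_of_halves)
qed

text \<open>With the history frozen, \<open>f\<close> is continuous in the input and its composition
  with \<open>u\<close> is measurable. Freezing the history at the grid points \<open>q n s\<close>
  glues countably many such pieces, and joint continuity gives pointwise convergence as the grid is
  refined. Clamping to \<open>{0..T}\<close> keeps the segment in \<open>Xspace\<close> when a grid
  point leaves the interval.\<close>

lemma measurable_rhs: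
  assumes x: "continuous_on {-\<theta>..T} x" and T: "T \<ge> 0" and u: "u \<in> borel_measurable borel"
  shows "(\<lambda>s. f (seg \<theta> x (max 0 (min T s))) (u s)) \<in> borel_measurable borel"
proof -
  define c where "c s = max 0 (min T s)" for s
  have c: "c s \<in> {0..T}" for s using T by (auto simp: c_def)
  define q where "q n s = of_int \<lfloor>real (Suc n) * s\<rfloor> / real (Suc n)" for n s
  have q: "\<bar>q n s - s\<bar> \<le> 1 / real (Suc n)" for n s
  proof -
    have "\<bar>of_int \<lfloor>real (Suc n) * s\<rfloor> - real (Suc n) * s\<bar> \<le> 1" by linarith
    then have "\<bar>of_int \<lfloor>real (Suc n) * s\<rfloor> - real (Suc n) * s\<bar> / real (Suc n) \<le> 1 / real (Suc n)"
      by (intro divide_right_mono) auto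
    moreover have "\<bar>of_int \<lfloor>real (Suc n) * s\<rfloor> - real (Suc n) * s\<bar> / real (Suc n) = \<bar>q n s - s\<bar>"
      by (simp add: q_def field_simps flip: abs_divide)
    ultimately show ?thesis by simp
  qed
  have "(\<lambda>s. f (seg \<theta> x (c s)) (u s)) \<in> borel_measurable borel"
  proof (rule borel_measurable_LIMSEQ_metric)
    fix n
    show "(\<lambda>s. f (seg \<theta> x (c (q n s))) (u s)) \<in> borel_measurable borel"
      unfolding q_def
    proof (rule measurable_compose_countable[where f = "\<lambda>i s. f (seg \<theta> x (c (of_int i / real (Suc n)))) (u s)"])
      fix i :: int
      have "seg \<theta> x (c (of_int i / real (Suc n))) \<in> Xspace \<theta>"
        using seg_in_Xspace[OF x c] .
      then have "continuous_on UNIV (f (seg \<theta> x (c (of_int i / real (Suc n)))))"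
        by (rule continuous_in_input)
      then show "(\<lambda>s. f (seg \<theta> x (c (of_int i / real (Suc n)))) (u s)) \<in> borel_measurable borel"
        using u by (rule borel_measurable_continuous_on)
    qed measurable
  next
    fix s
    show "(\<lambda>n. f (seg \<theta> x (c (q n s))) (u s)) \<longlonglongrightarrow> f (seg \<theta> x (c s)) (u s)"
    proof (rule LIMSEQ_I)
      fix e :: real assume "e > 0"
      then obtain d where d: "d > 0" "\<forall>\<eta>\<in>Xspace \<theta>. \<forall>w. normX \<theta> (\<eta> - seg \<theta> x (c s)) < d \<and> norm (w - u s) < d
          \<longrightarrow> norm (f \<eta> w - f (seg \<theta> x (c s)) (u s)) < e"
        using continuous_in_state_and_input[OF seg_in_Xspace[OF x c]] by blast
      obtain d' where d': "d' > 0" "\<forall>s'\<in>{0..T}. \<bar>s' - c s\<bar> < d' \<longrightarrow> normX \<theta> (seg \<theta> x s' - seg \<theta> x (c s)) < d"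
        using seg_continuous[OF x c d(1)] by blast
      obtain N where N: "1 / real (Suc N) < d'" using d'(1) nat_approx_posE by blast
      have "norm (f (seg \<theta> x (c (q n s))) (u s) - f (seg \<theta> x (c s)) (u s)) < e" if "n \<ge> N" for n
      proof -
        have "\<bar>c (q n s) - c s\<bar> \<le> \<bar>q n s - s\<bar>" by (auto simp: c_def max_def min_def)
        also have "\<dots> \<le> 1 / real (Suc n)" by (rule q)
        also have "\<dots> \<le> 1 / real (Suc N)" using that by (simp add: frac_le)
        finally have "\<bar>c (q n s) - c s\<bar> < d'" using N by simp
        then show ?thesis using d d'(2) c seg_in_Xspace[OF x c] by simp
      qed
      then show "\<exists>N. \<forall>n\<ge>N. norm (f (seg \<theta> x (c (q n s))) (u s) - f (seg \<theta> x (c s)) (u s)) < e"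
        by blast
    qed
  qed
  then show ?thesis by (simp add: c_def)
qed

lemma normX_seg_le:
  assumes "t \<in> {0..T}" "\<And>s. s \<in> {-\<theta>..T} \<Longrightarrow> norm (x s) \<le> B"
  shows "normX \<theta> (seg \<theta> x t) \<le> B"
  using assms delay_pos by (intro normX_le) (auto simp: seg_apply)

text \<open>Integrability is part of \<open>sol_on\<close>; the solutions constructed later, by
  fixed points and by concatenation, obtain it from here.\<close>

lemma rhs_absolutely_integrable:
  assumes x: "continuous_on {-\<theta>..T} x" and T: "T \<ge> 0" and u: "bounded_input r u"
  shows "(\<lambda>s. f (seg \<theta> x s) (u s)) absolutely_integrable_on {0..T}"
proof -
  have "bounded (x ` {-\<theta>..T})"
    using x by (intro compact_imp_bounded compact_continuous_image) auto
  then obtain B where B: "\<And>s. s \<in> {-\<theta>..T} \<Longrightarrow> norm (x s) \<le> B"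
    unfolding bounded_iff by (metis imageI)
  obtain C where C: "\<forall>\<xi>\<in>Xspace \<theta>. \<forall>v. normX \<theta> \<xi> \<le> max B r \<and> norm v \<le> max B r \<longrightarrow> norm (f \<xi> v) \<le> C"
    using bounded_f unfolding bounded_on_bounded_def by blast
  show ?thesis
  proof (rule measurable_bounded_by_integrable_imp_absolutely_integrable[where g = "\<lambda>_. C"])
    have "(\<lambda>s. f (seg \<theta> x (max 0 (min T s))) (u s)) \<in> borel_measurable lebesgue"
      using measurable_rhs[OF x T] u by (simp add: bounded_input_def measurable_completion)
    then have "(\<lambda>s. f (seg \<theta> x (max 0 (min T s))) (u s)) \<in> borel_measurable (lebesgue_on {0..T})"
      by (rule measurable_restrict_space1)
    then show "(\<lambda>s. f (seg \<theta> x s) (u s)) \<in> borel_measurable (lebesgue_on {0..T})"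
      by (rule measurable_cong[THEN iffD1, rotated]) (auto simp: min_def max_def)
    fix s assume s: "s \<in> {0..T}"
    have "normX \<theta> (seg \<theta> x s) \<le> B" using normX_seg_le[OF s B] .
    then show "norm (f (seg \<theta> x s) (u s)) \<le> C"
      using C seg_in_Xspace[OF x s] u by (simp add: bounded_input_def le_max_iff_disj)
  qed auto
qed

section \<open>Continuity, comparison and uniqueness of solutions\<close>

lemma sol_on_continuous:
  assumes \<xi>: "\<xi> \<in> Xspace \<theta>" and x: "sol_on \<theta> f \<xi> u T x"
  shows "continuous_on {-\<theta>..T} x"
proof (cases "T \<ge> 0")
  case True
  have "(\<lambda>s. f (seg \<theta> x s) (u s)) integrable_on {0..T}"
    using x by (simp add: sol_on_def absolutely_integrable_on_def)
  then have "continuous_on {0..T} (\<lambda>t. \<xi> 0 + integral {0..t} (\<lambda>s. f (seg \<theta> x s) (u s)))"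
    by (intro continuous_intros indefinite_integral_continuous_1)
  then have "continuous_on {0..T} x"
    by (rule continuous_on_eq) (use x in \<open>simp add: sol_on_def\<close>)
  moreover have "continuous_on {-\<theta>..0} x"
    by (rule continuous_on_eq[of _ \<xi>]) (use x \<xi> in \<open>auto simp: sol_on_def Xspace_def\<close>)
  ultimately have "continuous_on ({-\<theta>..0} \<union> {0..T}) x"
    by (intro continuous_on_closed_Un) auto
  then show ?thesis
    using True delay_pos by (simp add: ivl_disj_un_two_touch)
next
  case False
  have "continuous_on {-\<theta>..0} x"
    by (rule continuous_on_eq[of _ \<xi>]) (use x \<xi> in \<open>auto simp: sol_on_def Xspace_def\<close>)
  then show ?thesis by (rule continuous_on_subset) (use False in auto)
qed

lemma sol_on_mono:
  assumes "sol_on \<theta> f \<xi> u T x" "S \<le> T"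
  shows "sol_on \<theta> f \<xi> u S x"
  using assms unfolding sol_on_def
  by (auto intro: absolutely_integrable_on_subinterval)

lemma sol_on_initial: "sol_on \<theta> f \<xi> u T x \<Longrightarrow> s \<in> {-\<theta>..0} \<Longrightarrow> x s = \<xi> s"
  by (simp add: sol_on_def)

text \<open>The supremum \<open>m\<close> of the difference, weighted by \<open>exp (-2 L t)\<close>, satisfies \<open>m \<le> d + m / 2\<close>.\<close>

lemma gronwall:
  assumes \<xi>: "\<xi>1 \<in> Xspace \<theta>" "\<xi>2 \<in> Xspace \<theta>"
    and x: "sol_on \<theta> f \<xi>1 u T x1" "sol_on \<theta> f \<xi>2 u T x2" and T: "T \<ge> 0" and L: "L > 0"
    and lip: "\<And>s. s \<in> {0..T} \<Longrightarrow> norm (f (seg \<theta> x1 s) (u s) - f (seg \<theta> x2 s) (u s))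
      \<le> L * normX \<theta> (seg \<theta> x1 s - seg \<theta> x2 s)"
    and t: "t \<in> {-\<theta>..T}"
  shows "norm (x1 t - x2 t) \<le> 2 * exp (2 * L * T) * normX \<theta> (\<xi>1 - \<xi>2)"
proof -
  define d where "d = normX \<theta> (\<xi>1 - \<xi>2)"
  define w where "w t = exp (- (2 * L * t)) * norm (x1 t - x2 t)" for t
  have d: "d \<ge> 0" unfolding d_def using \<xi> delay_pos by (simp add: normX_nonneg Xspace_diff)
  have init: "norm (x1 s - x2 s) \<le> d" if "s \<in> {-\<theta>..0}" for s
    using norm_le_normX[OF Xspace_diff[OF \<xi>] that] sol_on_initial[OF x(1) that] sol_on_initial[OF x(2) that]
    by (simp add: d_def)
  have cx: "continuous_on {-\<theta>..T} x1" "continuous_on {-\<theta>..T} x2"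
    using sol_on_continuous \<xi> x by blast+
  then have "continuous_on {0..T} x1" "continuous_on {0..T} x2"
    using delay_pos by (auto elim!: continuous_on_subset)
  then have "continuous_on {0..T} w"
    unfolding w_def by (intro continuous_intros)
  then obtain t0 where t0: "t0 \<in> {0..T}" "\<And>s. s \<in> {0..T} \<Longrightarrow> w s \<le> w t0"
    using continuous_attains_sup[of "{0..T}" w] T by auto
  \<comment> \<open>Segments reach back into the initial history, where the difference is at most
    \<open>d\<close>; the maximum lets \<open>m\<close> cover that part too.\<close>
  define m where "m = max (w t0) d"
  have m: "m \<ge> 0" "w t0 \<le> m" "d \<le> m" using d by (auto simp: m_def)
  have le: "norm (x1 s - x2 s) \<le> m * exp (2 * L * s)" if "s \<in> {0..T}" for s
  proof -
    have "w s \<le> m" using t0(2)[OF that] m by simp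
    then have "w s * exp (2 * L * s) \<le> m * exp (2 * L * s)" by (rule mult_right_mono) simp
    then show ?thesis by (simp add: w_def mult.commute mult.left_commute flip: exp_add)
  qed
  have segle: "normX \<theta> (seg \<theta> x1 s - seg \<theta> x2 s) \<le> m * exp (2 * L * s)" if s: "s \<in> {0..T}" for s
  proof (rule normX_le)
    fix \<tau> assume \<tau>: "\<tau> \<in> {-\<theta>..0}"
    have "norm (x1 (s + \<tau>) - x2 (s + \<tau>)) \<le> m * exp (2 * L * s)"
    proof (cases "s + \<tau> \<ge> 0")
      case True
      then have "norm (x1 (s + \<tau>) - x2 (s + \<tau>)) \<le> m * exp (2 * L * (s + \<tau>))"
        using s \<tau> by (intro le) auto
      also have "\<dots> \<le> m * exp (2 * L * s)"
        using \<tau> L m by (intro mult_left_mono) auto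
      finally show ?thesis .
    next
      case False
      then have "norm (x1 (s + \<tau>) - x2 (s + \<tau>)) \<le> m * 1"
        using init[of "s + \<tau>"] s \<tau> m by auto
      also have "\<dots> \<le> m * exp (2 * L * s)"
        using s L m by (intro mult_left_mono) auto
      finally show ?thesis .
    qed
    then show "norm ((seg \<theta> x1 s - seg \<theta> x2 s) \<tau>) \<le> m * exp (2 * L * s)"
      using \<tau> by (simp add: seg_apply)
  qed (use delay_pos in simp)
  have int: "(\<lambda>s. f (seg \<theta> x1 s) (u s)) integrable_on {0..t0}" "(\<lambda>s. f (seg \<theta> x2 s) (u s)) integrable_on {0..t0}"
    using sol_on_mono[OF x(1), of t0] sol_on_mono[OF x(2), of t0] t0
    by (auto simp: sol_on_def absolutely_integrable_on_def)
  \<comment> \<open>The rate is twice \<open>L\<close> so that integrating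
    \<open>L * m * exp (2 * L * s)\<close> leaves the factor \<open>1 / 2\<close>, which can be
    absorbed.\<close>
  have fti: "((\<lambda>s. L * (m * exp (2 * L * s))) has_integral
      (m / 2 * exp (2 * L * t0) - m / 2 * exp (2 * L * 0))) {0..t0}"
    using t0 L by (intro fundamental_theorem_of_calculus)
      (auto intro!: derivative_eq_intros simp flip: has_real_derivative_iff_has_vector_derivative)
  have "norm (integral {0..t0} (\<lambda>s. f (seg \<theta> x1 s) (u s) - f (seg \<theta> x2 s) (u s)))
      \<le> integral {0..t0} (\<lambda>s. L * (m * exp (2 * L * s)))"
  proof (rule integral_norm_bound_integral)
    fix s assume "s \<in> {0..t0}"
    then have s: "s \<in> {0..T}" using t0 by auto
    have "norm (f (seg \<theta> x1 s) (u s) - f (seg \<theta> x2 s) (u s)) \<le> L * normX \<theta> (seg \<theta> x1 s - seg \<theta> x2 s)"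
      by (rule lip[OF s])
    also have "\<dots> \<le> L * (m * exp (2 * L * s))"
      using segle[OF s] L by (intro mult_left_mono) auto
    finally show "norm (f (seg \<theta> x1 s) (u s) - f (seg \<theta> x2 s) (u s)) \<le> L * (m * exp (2 * L * s))" .
  qed (use int fti in \<open>auto intro: integrable_diff\<close>)
  also have "\<dots> = m / 2 * exp (2 * L * t0) - m / 2"
    unfolding integral_unique[OF fti] by simp
  also have "\<dots> \<le> m / 2 * exp (2 * L * t0)" using m by simp
  finally have "norm (integral {0..t0} (\<lambda>s. f (seg \<theta> x1 s) (u s) - f (seg \<theta> x2 s) (u s)))
      \<le> m / 2 * exp (2 * L * t0)" .
  moreover have "x1 t0 - x2 t0 = (\<xi>1 0 - \<xi>2 0) + integral {0..t0} (\<lambda>s. f (seg \<theta> x1 s) (u s) - f (seg \<theta> x2 s) (u s))"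
    using x t0 int by (simp add: sol_on_def integral_diff)
  moreover have "norm (\<xi>1 0 - \<xi>2 0) \<le> d"
    using init[of 0] sol_on_initial[OF x(1), of 0] sol_on_initial[OF x(2), of 0] delay_pos by simp
  ultimately have "norm (x1 t0 - x2 t0) \<le> d + m / 2 * exp (2 * L * t0)"
    by (smt (verit) norm_triangle_ineq)
  then have "w t0 \<le> exp (- (2 * L * t0)) * (d + m / 2 * exp (2 * L * t0))"
    unfolding w_def by (intro mult_left_mono) auto
  also have "\<dots> = exp (- (2 * L * t0)) * d + m / 2"
    by (simp add: algebra_simps flip: exp_add)
  also have "\<dots> \<le> 1 * d + m / 2"
    using d t0 L by (intro add_right_mono mult_right_mono) auto
  finally have m2: "m \<le> 2 * d" using d by (auto simp: m_def max_def split: if_splits)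
  have "norm (x1 t - x2 t) \<le> m * exp (2 * L * T)"
  proof -
    have "norm (x1 t - x2 t) \<le> m * exp (2 * L * max t 0)"
      using le[of t] init[of t] m t by (cases "t \<ge> 0") auto
    also have "\<dots> \<le> m * exp (2 * L * T)"
      using m L t T by (intro mult_left_mono) auto
    finally show ?thesis .
  qed
  also have "\<dots> \<le> 2 * d * exp (2 * L * T)"
    using m2 by (rule mult_right_mono) simp
  finally show ?thesis by (simp add: d_def ac_simps)
qed

lemma seg_diff_le:
  assumes "\<And>s. s \<in> {-\<theta>..T} \<Longrightarrow> norm (x s - y s) \<le> c" "t \<in> {0..T}"
  shows "normX \<theta> (seg \<theta> x t - seg \<theta> y t) \<le> c"
  using assms delay_pos by (intro normX_le) (auto simp: seg_apply)

text \<open>The Lipschitz estimate holds only within \<open>\<delta>\<close> of the reference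
  trajectory, so Gronwall cannot be used before closeness is known. The circle is broken at the
  first time \<open>s1\<close> at which the distance reaches \<open>\<delta> / 2\<close>: up to then
  the estimate is valid, and Gronwall with its factor 2 puts the distance at \<open>s1\<close>
  strictly below \<open>\<delta> / 2\<close>. Hence the factor 4 in the smallness condition.\<close>

lemma solution_stays_in_tube:
  assumes \<xi>: "\<xi>0 \<in> Xspace \<theta>" "\<xi> \<in> Xspace \<theta>"
    and x: "sol_on \<theta> f \<xi>0 u T x0" "sol_on \<theta> f \<xi> u T x" and T: "T \<ge> 0" and L: "L > 0"
    and lip: "\<And>s \<eta>. s \<in> {0..T} \<Longrightarrow> \<eta> \<in> Xspace \<theta> \<Longrightarrow> normX \<theta> (\<eta> - seg \<theta> x0 s) < \<delta>
      \<Longrightarrow> norm (f \<eta> (u s) - f (seg \<theta> x0 s) (u s)) \<le> L * normX \<theta> (\<eta> - seg \<theta> x0 s)"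
    and small: "4 * exp (2 * L * T) * normX \<theta> (\<xi> - \<xi>0) < \<delta>"
    and t: "t \<in> {-\<theta>..T}"
  shows "norm (x t - x0 t) < \<delta> / 2"
proof (rule ccontr)
  assume contra: "\<not> norm (x t - x0 t) < \<delta> / 2"
  define e where "e t = norm (x t - x0 t)" for t
  define d where "d = normX \<theta> (\<xi> - \<xi>0)"
  have d: "d \<ge> 0" unfolding d_def using \<xi> delay_pos by (simp add: normX_nonneg Xspace_diff)
  have "4 * d \<le> 4 * exp (2 * L * T) * d"
    using L T mult_right_mono[of 1 "exp (2 * L * T)" d] d by auto
  then have d\<delta>: "d < \<delta> / 2" "\<delta> > 0" using small d unfolding d_def[symmetric] by auto
  have init: "e s \<le> d" if "s \<in> {-\<theta>..0}" for s
    using norm_le_normX[OF Xspace_diff[OF \<xi>(2,1)] that] sol_on_initial[OF x(1) that] sol_on_initial[OF x(2) that]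
    by (simp add: d_def e_def)
  have cx: "continuous_on {-\<theta>..T} x0" "continuous_on {-\<theta>..T} x"
    using sol_on_continuous \<xi> x by blast+
  have ce: "continuous_on {-\<theta>..T} e"
    unfolding e_def using cx by (intro continuous_intros)
  define A where "A = {s \<in> {-\<theta>..T}. \<delta> / 2 \<le> e s}"
  have "closed ({-\<theta>..T} \<inter> e -` {\<delta> / 2..})"
    using ce by (intro continuous_closed_preimage) auto
  moreover have "A = {-\<theta>..T} \<inter> e -` {\<delta> / 2..}" by (auto simp: A_def)
  moreover have "bounded A"
    unfolding A_def by (rule bounded_subset[of "{-\<theta>..T}"]) auto
  ultimately have "compact A" by (simp add: compact_eq_bounded_closed)
  moreover have "A \<noteq> {}" using t contra by (auto simp: A_def e_def)
  ultimately obtain s1 where s1: "s1 \<in> A" "\<And>s. s \<in> A \<Longrightarrow> s1 \<le> s"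
    using compact_attains_inf[of A] by metis
  \<comment> \<open>Distances on the initial history are at most \<open>d\<close>, which is below
    \<open>\<delta> / 2\<close>, so the exit time is positive.\<close>
  have s1': "s1 \<in> {0<..T}" "\<delta> / 2 \<le> e s1"
    using s1(1) init[of s1] d\<delta> by (auto simp: A_def not_le[symmetric])
  have less: "e s \<le> \<delta> / 2" if "s \<in> {-\<theta>..<s1}" for s
    using s1(2)[of s] s1' that by (cases "\<delta> / 2 \<le> e s") (auto simp: A_def)
  have cl: "closure {-\<theta>..<s1} = {-\<theta>..s1}" using s1' delay_pos by simp
  \<comment> \<open>Minimality gives the bound before \<open>s1\<close>; continuity carries it to
    \<open>s1\<close>, so all segments up to \<open>s1\<close> stay within
    \<open>\<delta> / 2\<close> of the reference.\<close>
  have le: "e s \<le> \<delta> / 2" if "s \<in> {-\<theta>..s1}" for s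
  proof (rule continuous_le_on_closure[of "{-\<theta>..<s1}" e])
    show "continuous_on (closure {-\<theta>..<s1}) e"
      unfolding cl
      using s1' by (intro continuous_on_subset[OF ce]) auto
  qed (use less that cl in auto)
  have "norm (x s1 - x0 s1) \<le> 2 * exp (2 * L * s1) * normX \<theta> (\<xi> - \<xi>0)"
  proof (rule gronwall[OF \<xi>(2,1) sol_on_mono[OF x(2)] sol_on_mono[OF x(1)] _ L])
    fix s assume s: "s \<in> {0..s1}"
    have "normX \<theta> (seg \<theta> x s - seg \<theta> x0 s) \<le> \<delta> / 2"
      using le s by (intro seg_diff_le[of s1]) (auto simp: e_def)
    then show "norm (f (seg \<theta> x s) (u s) - f (seg \<theta> x0 s) (u s)) \<le> L * normX \<theta> (seg \<theta> x s - seg \<theta> x0 s)"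
      using s s1' d\<delta> by (intro lip seg_in_Xspace[OF cx(2)]) auto
  qed (use s1' delay_pos in auto)
  also have "\<dots> \<le> 2 * exp (2 * L * T) * normX \<theta> (\<xi> - \<xi>0)"
    using s1' L d by (intro mult_right_mono mult_left_mono) (auto simp: d_def)
  finally show False using small s1' by (simp add: e_def)
qed

text \<open>The compactness behind uniqueness. Uniqueness serves to construct global solutions, so
  it works with a single solution on a bounded interval instead of a reachable set.\<close>

lemma precompact_trajectory:
  assumes x: "continuous_on {-\<theta>..T} x"
  shows "precompactX \<theta> {seg \<theta> x s |s. s \<in> {0..T}}"
proof -
  have "bounded (x ` {-\<theta>..T})"
    using x by (intro compact_imp_bounded compact_continuous_image) auto
  then obtain B where B: "\<And>s. s \<in> {-\<theta>..T} \<Longrightarrow> norm (x s) \<le> B"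
    unfolding bounded_iff by (metis imageI)
  have "uniformly_continuous_on {-\<theta>..T} x"
    using x by (intro compact_uniformly_continuous) auto
  then have "\<exists>d>0. \<forall>\<phi>\<in>{x}. \<forall>a\<in>{-\<theta>..T}. \<forall>b\<in>{-\<theta>..T}. \<bar>a - b\<bar> < d \<longrightarrow> norm (\<phi> a - \<phi> b) < e"
    if "e > 0" for e
    using that unfolding uniformly_continuous_on_def dist_norm real_norm_def by (metis singletonD)
  then have "precompactX \<theta> {seg \<theta> \<phi> t |\<phi> t. \<phi> \<in> {x} \<and> t \<in> {0..T}}"
    using B by (intro precompactX_segments[OF delay_pos]) auto
  then show ?thesis by simp
qed

text \<open>For equal initial histories the smallness condition of the tube lemma holds
  automatically, so the second solution stays where \<open>f\<close> is Lipschitz around the first;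
  Gronwall with initial distance 0 then gives equality.\<close>

lemma sol_on_unique:
  assumes \<xi>: "\<xi> \<in> Xspace \<theta>" and u: "bounded_input r u"
    and x: "sol_on \<theta> f \<xi> u T x" "sol_on \<theta> f \<xi> u T y" and t: "t \<in> {-\<theta>..T}"
  shows "x t = y t"
proof (cases "T \<ge> 0")
  case True
  have cx: "continuous_on {-\<theta>..T} x" using sol_on_continuous \<xi> x by blast
  let ?K = "{seg \<theta> x s |s. s \<in> {0..T}}"
  have "?K \<subseteq> Xspace \<theta>" using seg_in_Xspace[OF cx] by auto
  from this precompact_trajectory[OF cx] obtain \<delta> L where \<delta>: "\<delta> > 0" "L > 0"
    and lip: "\<And>\<kappa> \<xi>1 \<xi>2 w. \<kappa> \<in> ?K \<Longrightarrow> \<xi>1 \<in> Xspace \<theta> \<Longrightarrow> \<xi>2 \<in> Xspace \<theta> \<Longrightarrow> normX \<theta> (\<xi>1 - \<kappa>) < \<delta>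
      \<Longrightarrow> normX \<theta> (\<xi>2 - \<kappa>) < \<delta> \<Longrightarrow> norm w \<le> r \<Longrightarrow> norm (f \<xi>1 w - f \<xi>2 w) \<le> L * normX \<theta> (\<xi>1 - \<xi>2)"
    by (rule lipschitz_near_precompact[where r = r]) blast
  have z: "normX \<theta> (\<eta> - \<eta>) = 0" for \<eta> :: "real \<Rightarrow> 'a"
    using delay_pos by (simp add: normX_diff_self)
  have tube: "norm (f \<eta> (u s) - f (seg \<theta> x s) (u s)) \<le> L * normX \<theta> (\<eta> - seg \<theta> x s)"
    if "s \<in> {0..T}" "\<eta> \<in> Xspace \<theta>" "normX \<theta> (\<eta> - seg \<theta> x s) < \<delta>" for s \<eta>
    using that u \<delta> seg_in_Xspace[OF cx] by (intro lip) (auto simp: z bounded_input_def)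
  have cy: "continuous_on {-\<theta>..T} y" using sol_on_continuous \<xi> x by blast
  have close: "norm (y s - x s) \<le> \<delta> / 2" if "s \<in> {-\<theta>..T}" for s
    using solution_stays_in_tube[where \<delta> = \<delta>, OF \<xi> \<xi> x True \<delta>(2) tube _ that] \<delta> z[of \<xi>] by simp
  have "norm (y t - x t) \<le> 2 * exp (2 * L * T) * normX \<theta> (\<xi> - \<xi>)"
  proof (rule gronwall[OF \<xi> \<xi> x(2,1) True \<delta>(2) _ t])
    fix s assume s: "s \<in> {0..T}"
    show "norm (f (seg \<theta> y s) (u s) - f (seg \<theta> x s) (u s)) \<le> L * normX \<theta> (seg \<theta> y s - seg \<theta> x s)"
      using seg_diff_le[where x = y and y = x, OF close s] \<delta> s by (intro tube seg_in_Xspace[OF cy]) auto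
  qed
  then show ?thesis using z[of \<xi>] by simp
next
  case False
  then show ?thesis using t sol_on_initial[OF x(1), of t] sol_on_initial[OF x(2), of t] by auto
qed

text \<open>The input enters a solution only under an integral, which ignores null sets. This
  transfers solutions to the everywhere bounded representative of an input.\<close>

lemma sol_on_cong_input:
  assumes x: "sol_on \<theta> f \<xi> u T x" and N: "negligible N" "\<And>t. t \<in> {0..T} \<Longrightarrow> t \<notin> N \<Longrightarrow> u' t = u t"
  shows "sol_on \<theta> f \<xi> u' T x"
proof -
  have "integral {0..t} (\<lambda>s. f (seg \<theta> x s) (u' s)) = integral {0..t} (\<lambda>s. f (seg \<theta> x s) (u s))" if "t \<in> {0..T}" for t
    by (rule integral_spike[OF N(1)]) (use that N in auto)
  moreover have "(\<lambda>s. f (seg \<theta> x s) (u' s)) absolutely_integrable_on {0..T}"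
    by (rule absolutely_integrable_spike[OF _ N(1)]) (use x N in \<open>auto simp: sol_on_def\<close>)
  ultimately show ?thesis using x by (simp add: sol_on_def)
qed

lemma sol_on_cong:
  assumes y: "sol_on \<theta> f \<xi> u T y" and eq: "\<And>t. t \<in> {-\<theta>..T} \<Longrightarrow> x t = y t" and T: "T \<ge> 0"
  shows "sol_on \<theta> f \<xi> u T x"
proof -
  have seg: "seg \<theta> x s = seg \<theta> y s" if "s \<in> {0..T}" for s
    using that by (intro seg_cong eq) auto
  have "integral {0..t} (\<lambda>s. f (seg \<theta> x s) (u s)) = integral {0..t} (\<lambda>s. f (seg \<theta> y s) (u s))" if "t \<in> {0..T}" for t
    using that by (intro integral_cong) (auto simp: seg)
  moreover have "(\<lambda>s. f (seg \<theta> x s) (u s)) absolutely_integrable_on {0..T}"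
    by (rule absolutely_integrable_spike[OF _ negligible_empty, where f = "\<lambda>s. f (seg \<theta> y s) (u s)"])
      (use y seg in \<open>auto simp: sol_on_def\<close>)
  ultimately show ?thesis using y eq T delay_pos by (simp add: sol_on_def)
qed

lemma sol_upto_sol_on:
  assumes "sol_upto \<theta> f \<xi> u \<infinity> x"
  shows "sol_on \<theta> f \<xi> u T x"
proof (rule sol_on_mono)
  show "sol_on \<theta> f \<xi> u (max T 1) x" using assms unfolding sol_upto_def by simp
qed simp

section \<open>Existence of local and global solutions\<close>

text \<open>The candidates are bounded continuous functions on the whole line, a complete metric
  space. The closed set \<open>S\<close> prescribes the history up to time 0 and keeps later values
  within \<open>\<delta> / 4\<close> of \<open>\<xi> 0\<close>; the integral operator
  \<open>F\<close> contracts it.\<close>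

lemma local_solution:
  assumes \<xi>: "\<xi> \<in> Xspace \<theta>" and u: "bounded_input r u"
  obtains T x where "T > 0" "sol_on \<theta> f \<xi> u T x"
proof -
  have "precompactX \<theta> {\<xi>}" using delay_pos \<xi> by (simp add: precompactX_singleton)
  moreover have "{\<xi>} \<subseteq> Xspace \<theta>" using \<xi> by simp
  from this calculation obtain \<delta> L where \<delta>: "\<delta> > 0" and L: "L > 0" and
    lip: "\<And>\<xi>1 \<xi>2 w. \<xi>1 \<in> Xspace \<theta> \<Longrightarrow> \<xi>2 \<in> Xspace \<theta> \<Longrightarrow> normX \<theta> (\<xi>1 - \<xi>) < \<delta>
      \<Longrightarrow> normX \<theta> (\<xi>2 - \<xi>) < \<delta> \<Longrightarrow> norm w \<le> r \<Longrightarrow> norm (f \<xi>1 w - f \<xi>2 w) \<le> L * normX \<theta> (\<xi>1 - \<xi>2)"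
    by (rule lipschitz_near_precompact[where r = r]) blast
  obtain C where C: "\<forall>\<eta>\<in>Xspace \<theta>. \<forall>v. normX \<theta> \<eta> \<le> max r (normX \<theta> \<xi> + \<delta>) \<and> norm v \<le> max r (normX \<theta> \<xi> + \<delta>) \<longrightarrow> norm (f \<eta> v) \<le> C"
    using bounded_f unfolding bounded_on_bounded_def by blast
  define M where "M = \<bar>C\<bar> + 1"
  have M: "M > 0" by (simp add: M_def)
  have "uniformly_continuous_on {-\<theta>..0} \<xi>"
    using \<xi> by (intro compact_uniformly_continuous) (auto simp: Xspace_def)
  then obtain d where d: "d > 0" "\<And>a b. a \<in> {-\<theta>..0} \<Longrightarrow> b \<in> {-\<theta>..0} \<Longrightarrow> dist b a < d \<Longrightarrow> dist (\<xi> b) (\<xi> a) < \<delta> / 4"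
    unfolding uniformly_continuous_on_def using \<delta> by (metis divide_pos_pos zero_less_numeral)
  \<comment> \<open>In this order, the bounds keep the oscillation of \<open>\<xi>\<close> over a
    shift by at most \<open>T\<close> below \<open>\<delta> / 4\<close>, the integral within
    \<open>\<delta> / 4\<close>, and the contraction factor at most \<open>1 / 2\<close>.\<close>
  define T where "T = min (d / 2) (min (\<delta> / (4 * M)) (1 / (2 * L)))"
  have T: "T > 0" "T < d" "M * T \<le> \<delta> / 4" "L * T \<le> 1 / 2"
  proof -
    show "T > 0" "T < d" using d \<delta> M L by (auto simp: T_def)
    have "T \<le> \<delta> / (4 * M)" "T \<le> 1 / (2 * L)" by (auto simp: T_def)
    then show "M * T \<le> \<delta> / 4" "L * T \<le> 1 / 2" using M L by (auto simp: field_simps)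
  qed
  \<comment> \<open>The history is continued constantly in both directions, which makes it bounded
    and continuous on the line; the integral in \<open>F\<close> is likewise frozen after time
    \<open>T\<close>.\<close>
  define \<xi>' where "\<xi>' t = \<xi> (max (-\<theta>) (min t 0))" for t
  have \<xi>': "continuous_on UNIV \<xi>'" "\<And>t. norm (\<xi>' t) \<le> normX \<theta> \<xi>"
  proof -
    show "continuous_on UNIV \<xi>'"
      unfolding \<xi>'_def
    proof (rule continuous_on_compose2[of "{-\<theta>..0}" \<xi>])
      show "continuous_on UNIV (\<lambda>t. max (-\<theta>) (min t 0))" by (intro continuous_intros)
    qed (use \<xi> delay_pos in \<open>auto simp: Xspace_def\<close>)
    show "norm (\<xi>' t) \<le> normX \<theta> \<xi>" for t
      unfolding \<xi>'_def using delay_pos by (intro norm_le_normX \<xi>) auto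
  qed
  define X where "X t = (if t \<le> 0 then {\<xi>' t} else cball (\<xi> 0) (\<delta> / 4))" for t
  define S where "S = PiC UNIV X"
  define g where "g \<phi> s = f (seg \<theta> \<phi> s) (u s)" for \<phi> s
  define F where "F \<phi> t = \<xi>' t + integral {0..max 0 (min t T)} (g \<phi>)" for \<phi> t
  have S: "apply_bcontfun \<phi> t \<in> X t" if "\<phi> \<in> S" for \<phi> t
    using that by (auto simp: S_def mem_PiC_iff)
  have segX: "seg \<theta> (apply_bcontfun \<phi>) s \<in> Xspace \<theta>" if "s \<in> {0..T}" for \<phi> s
    using that by (intro seg_in_Xspace[of _ T]) auto
  have near: "normX \<theta> (seg \<theta> (apply_bcontfun \<phi>) s - \<xi>) < \<delta>" if "\<phi> \<in> S" "s \<in> {0..T}" for \<phi> s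
  proof -
    have "normX \<theta> (seg \<theta> (apply_bcontfun \<phi>) s - \<xi>) \<le> \<delta> / 4 + \<delta> / 4"
    proof (rule normX_le)
      fix \<tau> assume \<tau>: "\<tau> \<in> {-\<theta>..0}"
      \<comment> \<open>Up to time 0 the shift moves along \<open>\<xi>\<close> itself by less than
        \<open>d\<close>. Afterwards the detour through \<open>\<xi> 0\<close> costs
        \<open>\<delta> / 4\<close> for \<open>\<phi>\<close> and \<open>\<delta> / 4\<close> for
        \<open>\<xi>\<close>, as \<open>\<tau>\<close> is then within \<open>d\<close> of 0.\<close>
      have "dist (\<phi> (s + \<tau>)) (\<xi> \<tau>) \<le> \<delta> / 4 + \<delta> / 4"
      proof (cases "s + \<tau> \<le> 0")
        case True
        then have "\<phi> (s + \<tau>) = \<xi> (s + \<tau>)"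
          using S[OF that(1), of "s + \<tau>"] \<tau> that by (auto simp: X_def \<xi>'_def)
        moreover have "dist (\<xi> (s + \<tau>)) (\<xi> \<tau>) < \<delta> / 4"
          using True \<tau> that T by (intro d) (auto simp: dist_norm)
        ultimately show ?thesis using \<delta> by simp
      next
        case False
        then have "dist (\<phi> (s + \<tau>)) (\<xi> 0) \<le> \<delta> / 4"
          using S[OF that(1), of "s + \<tau>"] by (auto simp: X_def dist_commute)
        moreover have "dist (\<xi> 0) (\<xi> \<tau>) < \<delta> / 4"
          using False \<tau> that T delay_pos by (intro d) (auto simp: dist_norm)
        ultimately show ?thesis using dist_triangle[of "\<phi> (s + \<tau>)" "\<xi> \<tau>" "\<xi> 0"] by linarith
      qed
      then show "norm ((seg \<theta> (apply_bcontfun \<phi>) s - \<xi>) \<tau>) \<le> \<delta> / 4 + \<delta> / 4"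
        using \<tau> by (simp add: seg_apply dist_norm)
    qed (use delay_pos in simp)
    then show ?thesis using \<delta> by simp
  qed
  have gM: "norm (g \<phi> s) \<le> M" if "\<phi> \<in> S" "s \<in> {0..T}" for \<phi> s
  proof -
    have "normX \<theta> (seg \<theta> (apply_bcontfun \<phi>) s) \<le> normX \<theta> \<xi> + \<delta>"
      using normX_le_add[OF _ segX[OF that(2), of \<phi>] \<xi>] near[OF that] delay_pos by linarith
    then have "norm (g \<phi> s) \<le> C"
      using C segX[OF that(2)] u by (auto simp: g_def bounded_input_def le_max_iff_disj)
    then show ?thesis by (simp add: M_def)
  qed
  have gint: "g (apply_bcontfun \<phi>) absolutely_integrable_on {0..T}" for \<phi>
    unfolding g_def using T by (intro rhs_absolutely_integrable[OF _ _ u]) auto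
  have gint': "g (apply_bcontfun \<phi>) integrable_on {0..t}" if "t \<le> T" for \<phi> t
    by (rule integrable_subinterval_real[of _ 0 T]) (use gint[of \<phi>] that in \<open>auto simp: absolutely_integrable_on_def\<close>)
  have Fcont: "continuous_on UNIV (F (apply_bcontfun \<phi>))" for \<phi>
  proof -
    have "continuous_on {0..T} (\<lambda>t. integral {0..t} (g \<phi>))"
      by (intro indefinite_integral_continuous_1 gint') simp
    then have "continuous_on UNIV (\<lambda>t. integral {0..max 0 (min t T)} (g \<phi>))"
    proof (rule continuous_on_compose2)
      show "continuous_on UNIV (\<lambda>t. max 0 (min t T))" by (intro continuous_intros)
    qed (use T in auto)
    then show ?thesis
      unfolding F_def using \<xi>'(1) by (rule continuous_on_add[rotated])
  qed
  have Fb: "norm (F \<phi> t - \<xi>' t) \<le> \<delta> / 4" if "\<phi> \<in> S" for \<phi> t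
  proof -
    define b where "b = max 0 (min t T)"
    have b: "0 \<le> b" "b \<le> T" using T by (auto simp: b_def)
    have "norm (integral {0..b} (g \<phi>)) \<le> M * measure lborel {0..b}"
    proof (rule has_integral_bound_real[where S = "{}"])
      show "(g \<phi> has_integral integral {0..b} (g \<phi>)) {0..b}"
        using b by (intro integrable_integral gint')
    qed (use M b gM[OF that] in auto)
    also have "\<dots> \<le> M * T" using M b by simp
    finally show ?thesis using T by (simp add: F_def b_def)
  qed
  \<comment> \<open>\<open>Fb\<close> makes \<open>F \<phi>\<close> bounded for
    \<open>\<phi>\<close> in \<open>S\<close>, so on \<open>S\<close> the map \<open>G\<close>
    really represents \<open>F\<close>.\<close>
  define G where "G \<phi> = Bcontfun (F (apply_bcontfun \<phi>))" for \<phi>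
  have G: "apply_bcontfun (G \<phi>) = F \<phi>" if "\<phi> \<in> S" for \<phi>
    unfolding G_def
  proof (rule Bcontfun_inverse, rule bcontfun_normI[OF Fcont])
    fix t
    show "norm (F \<phi> t) \<le> normX \<theta> \<xi> + \<delta> / 4"
      using norm_triangle_ineq[of "\<xi>' t" "F \<phi> t - \<xi>' t"] \<xi>'(2)[of t] Fb[OF that, of t] by simp
  qed
  have \<xi>'0: "\<xi>' t = \<xi> 0" if "t \<ge> 0" for t using that delay_pos by (auto simp: \<xi>'_def max_def min_def)
  have "\<exists>!\<phi>\<in>S. G \<phi> = \<phi>"
  proof (rule Banach_fix)
    have "closed S" unfolding S_def by (rule closed_PiC) (auto simp: X_def)
    then show "complete S" by (simp add: complete_eq_closed)
    have "Bcontfun \<xi>' \<in> S"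
      unfolding S_def mem_PiC_iff
      by (subst Bcontfun_inverse) (use \<xi>' \<xi>'0 \<delta> in \<open>auto simp: X_def intro!: bcontfun_normI[of _ "normX \<theta> \<xi>"]\<close>)
    then show "S \<noteq> {}" by blast
    show "G ` S \<subseteq> S"
    proof clarify
      fix \<phi> assume \<phi>: "\<phi> \<in> S"
      have "F \<phi> t \<in> X t" for t
        using Fb[OF \<phi>, of t] \<xi>'0[of t]
        by (cases "t \<le> 0") (auto simp: X_def F_def dist_norm norm_minus_commute)
      then show "G \<phi> \<in> S"
        unfolding S_def mem_PiC_iff G[OF \<phi>] by simp
    qed
    fix \<phi> \<psi> assume \<phi>: "\<phi> \<in> S" and \<psi>: "\<psi> \<in> S"
    show "dist (G \<phi>) (G \<psi>) \<le> 1 / 2 * dist \<phi> \<psi>"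
    proof (rule dist_bound)
      fix t
      define b where "b = max 0 (min t T)"
      have b: "0 \<le> b" "b \<le> T" using T by (auto simp: b_def)
      have "norm (integral {0..b} (\<lambda>s. g \<phi> s - g \<psi> s)) \<le> (L * dist \<phi> \<psi>) * measure lborel {0..b}"
      proof (rule has_integral_bound_real[where S = "{}"])
        show "((\<lambda>s. g \<phi> s - g \<psi> s) has_integral integral {0..b} (\<lambda>s. g \<phi> s - g \<psi> s)) {0..b}"
          using b by (intro integrable_integral integrable_diff gint')
        fix s assume "s \<in> {0..b} - {}"
        then have s: "s \<in> {0..T}" using b by auto
        have "normX \<theta> (seg \<theta> \<phi> s - seg \<theta> \<psi> s) \<le> dist \<phi> \<psi>"
          using dist_bounded[of \<phi> _ \<psi>] by (intro seg_diff_le[OF _ s]) (simp add: dist_norm)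
        moreover have "norm (g \<phi> s - g \<psi> s) \<le> L * normX \<theta> (seg \<theta> \<phi> s - seg \<theta> \<psi> s)"
          unfolding g_def using u by (intro lip segX near \<phi> \<psi> s) (simp add: bounded_input_def)
        ultimately show "norm (g \<phi> s - g \<psi> s) \<le> L * dist \<phi> \<psi>"
          using L by (meson less_imp_le mult_left_mono order_trans)
      qed (use L in auto)
      also have "\<dots> \<le> (L * dist \<phi> \<psi>) * T" using b L by (intro mult_left_mono) auto
      also have "\<dots> = (L * T) * dist \<phi> \<psi>" by simp
      also have "\<dots> \<le> 1 / 2 * dist \<phi> \<psi>" using T by (intro mult_right_mono) auto
      finally show "dist (G \<phi> t) (G \<psi> t) \<le> 1 / 2 * dist \<phi> \<psi>"
        using b by (simp add: G \<phi> \<psi> F_def b_def[symmetric] dist_norm integral_diff gint')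
    qed
  qed auto
  then obtain \<phi> where \<phi>: "\<phi> \<in> S" "G \<phi> = \<phi>" by blast
  then have eq: "apply_bcontfun \<phi> t = F \<phi> t" for t using G by metis
  have "sol_on \<theta> f \<xi> u T \<phi>"
    unfolding sol_on_def
  proof (intro conjI ballI)
    show "\<phi> s = \<xi> s" if "s \<in> {-\<theta>..0}" for s
      using that by (subst eq) (auto simp: F_def \<xi>'_def)
    show "(\<lambda>s. f (seg \<theta> \<phi> s) (u s)) absolutely_integrable_on {0..T}"
      using gint unfolding g_def .
    show "\<phi> t = \<xi> 0 + integral {0..t} (\<lambda>s. f (seg \<theta> \<phi> s) (u s))" if "t \<in> {0..T}" for t
      using that by (subst eq) (auto simp: F_def \<xi>'0 g_def[abs_def])
  qed
  with T(1) show ?thesis by (rule that)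
qed

text \<open>\<open>forward_complete\<close> says that maximal solutions are global, but not that
  there is one. All local solutions agree by uniqueness and glue to a solution up to the supremum
  \<open>b\<close> of their end times. It is maximal, because a proper extension would contain a
  local solution ending beyond \<open>b\<close>.\<close>

lemma global_solution:
  assumes fc: "forward_complete \<theta> f" and \<xi>: "\<xi> \<in> Xspace \<theta>" and u: "bounded_input r u"
  obtains x where "sol_upto \<theta> f \<xi> u \<infinity> x"
proof -
  define S where "S = {T. T > 0 \<and> (\<exists>x. sol_on \<theta> f \<xi> u T x)}"
  define Y where "Y T = (SOME x. sol_on \<theta> f \<xi> u T x)" for T
  have Y: "sol_on \<theta> f \<xi> u T (Y T)" if "T \<in> S" for T
    using that unfolding S_def Y_def by (metis (mono_tags, lifting) mem_Collect_eq someI_ex)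
  define x where "x t = Y (SOME T. T \<in> S \<and> t \<le> T) t" for t
  define b where "b = (SUP T\<in>S. ereal T)"
  obtain T0 x0 where "T0 > 0" "sol_on \<theta> f \<xi> u T0 x0" using local_solution[OF \<xi> u] .
  then have T0: "T0 \<in> S" by (auto simp: S_def)
  have x: "sol_on \<theta> f \<xi> u T x" if "T \<in> S" for T
  proof (rule sol_on_cong[OF Y[OF that]])
    fix t assume t: "t \<in> {-\<theta>..T}"
    define T' where "T' = (SOME T. T \<in> S \<and> t \<le> T)"
    have T': "T' \<in> S \<and> t \<le> T'"
      unfolding T'_def by (rule someI[of _ T]) (use t that in auto)
    have "Y T' t = Y T t"
      using sol_on_unique[OF \<xi> u sol_on_mono[OF Y, of T' "min T T'"] sol_on_mono[OF Y, of T "min T T'"], of t] T' t that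
      by auto
    then show "x t = Y T t" by (simp add: x_def T'_def)
  qed (use that in \<open>auto simp: S_def\<close>)
  have "b > 0" using T0 unfolding b_def S_def by (auto simp: less_SUP_iff)
  have upto: "sol_upto \<theta> f \<xi> u b x"
    unfolding sol_upto_def
  proof (intro conjI allI impI \<open>b > 0\<close>)
    fix T assume "0 < T \<and> ereal T < b"
    then obtain T' where "T' \<in> S" "T < T'" unfolding b_def less_SUP_iff by auto
    then show "sol_on \<theta> f \<xi> u T x" using x sol_on_mono by (meson less_imp_le)
  qed
  have "maximal_sol \<theta> f \<xi> u b x"
    unfolding maximal_sol_def
  proof (intro conjI upto notI)
    assume "\<exists>b' x'. b' > b \<and> sol_upto \<theta> f \<xi> u b' x' \<and> (\<forall>t. -\<theta> \<le> t \<and> ereal t < b \<longrightarrow> x' t = x t)"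
    then obtain b' x' where b': "b' > b" "sol_upto \<theta> f \<xi> u b' x'" by blast
    \<comment> \<open>\<open>sol_upto\<close> provides solutions for end times strictly below
      \<open>b'\<close>, hence an intermediate \<open>T\<close>.\<close>
    then obtain T where T: "b < ereal T" "ereal T < b'" using ereal_dense2 by blast
    moreover have "T > 0" using T(1) \<open>b > 0\<close> by (metis ereal_less(2) order_less_trans)
    ultimately have "T \<in> S" using b' by (auto simp: S_def sol_upto_def)
    then have "ereal T \<le> b" unfolding b_def by (rule SUP_upper)
    then show False using T by simp
  qed
  then have "b = \<infinity>"
    using fc \<xi> bounded_input_in_inputs(1)[OF u] unfolding forward_complete_def by blast
  with upto that show ?thesis by simp
qed

lemma seg_solution_in_Xspace:
  assumes "\<xi> \<in> Xspace \<theta>" "sol_upto \<theta> f \<xi> u \<infinity> x" "t \<ge> 0"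
  shows "seg \<theta> x t \<in> Xspace \<theta>"
  using seg_in_Xspace[OF sol_on_continuous[OF assms(1) sol_upto_sol_on[OF assms(2)]], of t t] assms(3) by simp

section \<open>Reachable segments and dependence on the initial history\<close>

text \<open>RFC bounds the trajectories, hence \<open>f\<close> along them by some \<open>M\<close>,
  so on \<open>{0..T}\<close> they are all \<open>M\<close>-Lipschitz; up to time 0 they coincide
  with \<open>\<xi>\<close>, which is uniformly continuous. A whole ball of initial histories would
  have no common modulus there.\<close>

lemma precompact_reachable:
  assumes rfc: "RFC \<theta> f" and \<xi>: "\<xi> \<in> Xspace \<theta>" and T: "T > 0"
  shows "precompactX \<theta> {seg \<theta> x t |x t. (\<exists>u. bounded_input R u \<and> sol_upto \<theta> f \<xi> u \<infinity> x) \<and> t \<in> {0..T}}"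
proof -
  define \<Phi> where "\<Phi> = {x. \<exists>u. bounded_input R u \<and> sol_upto \<theta> f \<xi> u \<infinity> x}"
  \<comment> \<open>RFC takes one positive radius for both histories and inputs.\<close>
  define R' where "R' = max 1 (max R (normX \<theta> \<xi>))"
  have "R' > 0" by (simp add: R'_def)
  with rfc T obtain C where C: "\<forall>\<eta>\<in>Xspace \<theta>. \<forall>u\<in>inputs. \<forall>x. normX \<theta> \<eta> \<le> R' \<and> normU u \<le> ereal R'
      \<and> sol_upto \<theta> f \<eta> u \<infinity> x \<longrightarrow> (\<forall>t\<in>{0..T}. normX \<theta> (seg \<theta> x t) \<le> C)"
    unfolding RFC_def by blast
  have segC: "normX \<theta> (seg \<theta> x t) \<le> C" if "bounded_input R u" "sol_upto \<theta> f \<xi> u \<infinity> x" "t \<in> {0..T}" for u x t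
  proof -
    have "bounded_input R' u" using that(1) by (rule bounded_input_mono) (simp add: R'_def)
    then have "u \<in> inputs" "normU u \<le> ereal R'" by (rule bounded_input_in_inputs)+
    moreover have "normX \<theta> \<xi> \<le> R'" by (simp add: R'_def)
    ultimately show ?thesis using C \<xi> that by blast
  qed
  have cx: "continuous_on {-\<theta>..T} x" if "sol_upto \<theta> f \<xi> u \<infinity> x" for u x
    using sol_on_continuous[OF \<xi> sol_upto_sol_on[OF that]] .
  have bnd: "norm (x s) \<le> C" if x: "x \<in> \<Phi>" and s: "s \<in> {-\<theta>..T}" for x s
  proof -
    obtain u where u: "bounded_input R u" "sol_upto \<theta> f \<xi> u \<infinity> x" using x by (auto simp: \<Phi>_def)
    \<comment> \<open>RFC bounds segments at nonnegative times; the value at \<open>s\<close> is the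
      entry at offset \<open>min s 0\<close> of the segment at \<open>max s 0\<close>.\<close>
    have t: "max s 0 \<in> {0..T}" "min s 0 \<in> {-\<theta>..0}" using s T delay_pos by auto
    have "norm (seg \<theta> x (max s 0) (min s 0)) \<le> normX \<theta> (seg \<theta> x (max s 0))"
      by (intro norm_le_normX seg_in_Xspace[OF cx[OF u(2)]] t)
    also have "\<dots> \<le> C" by (rule segC[OF u t(1)])
    finally have "norm (x (max s 0 + min s 0)) \<le> C" using t(2) by (simp add: seg_apply)
    moreover have "max s 0 + min s 0 = s" by linarith
    ultimately show ?thesis by simp
  qed
  obtain M' where M': "\<forall>\<eta>\<in>Xspace \<theta>. \<forall>v. normX \<theta> \<eta> \<le> max C R \<and> norm v \<le> max C R \<longrightarrow> norm (f \<eta> v) \<le> M'"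
    using bounded_f unfolding bounded_on_bounded_def by blast
  define M where "M = \<bar>M'\<bar> + 1"
  have M: "M > 0" by (simp add: M_def)
  have lipx: "norm (x b - x a) \<le> M * (b - a)" if x: "x \<in> \<Phi>" and ab: "0 \<le> a" "a \<le> b" "b \<le> T" for x a b
  proof -
    obtain u where u: "bounded_input R u" "sol_upto \<theta> f \<xi> u \<infinity> x" using x by (auto simp: \<Phi>_def)
    define g where "g s = f (seg \<theta> x s) (u s)" for s
    have sol: "sol_on \<theta> f \<xi> u T x" using sol_upto_sol_on[OF u(2)] .
    have int: "g integrable_on {0..T}"
      using sol by (auto simp: sol_on_def g_def[abs_def] absolutely_integrable_on_def)
    have "integral {0..a} g + integral {a..b} g = integral {0..b} g"
      using ab by (intro Henstock_Kurzweil_Integration.integral_combine integrable_subinterval_real[OF int]) auto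
    moreover have "x b = \<xi> 0 + integral {0..b} g" "x a = \<xi> 0 + integral {0..a} g"
      using sol ab by (auto simp: sol_on_def g_def[abs_def])
    ultimately have "x b - x a = integral {a..b} g" by (simp add: algebra_simps)
    also have "norm \<dots> \<le> M * measure lborel {a..b}"
    proof (rule has_integral_bound_real[where S = "{}"])
      show "(g has_integral integral {a..b} g) {a..b}"
        using ab by (intro integrable_integral integrable_subinterval_real[OF int]) auto
      fix s assume "s \<in> {a..b} - {}"
      then have s: "s \<in> {0..T}" using ab by auto
      have "norm (g s) \<le> M'"
        using M' seg_in_Xspace[OF cx[OF u(2)] s] segC[OF u s] u(1)
        by (simp add: g_def bounded_input_def le_max_iff_disj)
      then show "norm (g s) \<le> M" by (simp add: M_def)
    qed (use M in auto)
    finally show ?thesis using ab by simp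
  qed
  have lipx': "norm (x a - x b) \<le> M * \<bar>a - b\<bar>" if x: "x \<in> \<Phi>" and ab: "a \<in> {0..T}" "b \<in> {0..T}" for x a b
    using lipx[OF x, of a b] lipx[OF x, of b a] ab
    by (cases "a \<le> b") (simp_all add: norm_minus_commute[of "x a" "x b"] abs_real_def)
  have "uniformly_continuous_on {-\<theta>..0} \<xi>"
    using \<xi> by (intro compact_uniformly_continuous) (auto simp: Xspace_def)
  then have uc: "\<exists>d>0. \<forall>a\<in>{-\<theta>..0}. \<forall>b\<in>{-\<theta>..0}. dist b a < d \<longrightarrow> dist (\<xi> b) (\<xi> a) < e" if "e > 0" for e
    using that unfolding uniformly_continuous_on_def by blast
  have "precompactX \<theta> {seg \<theta> x t |x t. x \<in> \<Phi> \<and> t \<in> {0..T}}"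
  proof (rule precompactX_segments[OF delay_pos])
    show "norm (x s) \<le> C" if "x \<in> \<Phi>" "s \<in> {-\<theta>..T}" for x s using bnd that .
    fix e :: real assume e: "e > 0"
    obtain d where d: "d > 0" "\<forall>a\<in>{-\<theta>..0}. \<forall>b\<in>{-\<theta>..0}. dist b a < d \<longrightarrow> dist (\<xi> b) (\<xi> a) < e / 2"
      using uc[of "e / 2"] e by auto
    define d' where "d' = min d (e / (2 * M))"
    have "d' > 0" using d M e by (simp add: d'_def)
    moreover have "norm (x a - x b) < e"
      if x: "x \<in> \<Phi>" and ab: "a \<in> {-\<theta>..T}" "b \<in> {-\<theta>..T}" "\<bar>a - b\<bar> < d'" for x a b
    proof -
      have init: "x s = \<xi> s" if "s \<in> {-\<theta>..0}" for s
        using x sol_on_initial[OF sol_upto_sol_on that] by (auto simp: \<Phi>_def)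
      \<comment> \<open>The history part and the increment part each have their own modulus, which
        treats all sign combinations of \<open>a\<close> and \<open>b\<close> at once.\<close>
      have split: "x s = \<xi> (min s 0) + (x (max s 0) - \<xi> 0)" if "s \<in> {-\<theta>..T}" for s
        using init[of s] init[of 0] that delay_pos by (cases "s \<le> 0") auto
      have "dist (\<xi> (min a 0)) (\<xi> (min b 0)) < e / 2"
        using ab T delay_pos by (intro d(2)[rule_format]) (auto simp: dist_real_def d'_def)
      moreover have "norm (x (max a 0) - x (max b 0)) \<le> e / 2"
      proof -
        have "norm (x (max a 0) - x (max b 0)) \<le> M * \<bar>max a 0 - max b 0\<bar>"
          using ab T by (intro lipx'[OF x]) auto
        also have "\<dots> \<le> M * (e / (2 * M))"
          using ab M by (intro mult_left_mono) (auto simp: d'_def)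
        also have "\<dots> = e / 2" using M by simp
        finally show ?thesis .
      qed
      moreover have "x a - x b = (\<xi> (min a 0) - \<xi> (min b 0)) + (x (max a 0) - x (max b 0))"
        by (subst split[OF ab(1)], subst split[OF ab(2)]) (simp add: algebra_simps)
      ultimately show ?thesis
        using norm_triangle_ineq[of "\<xi> (min a 0) - \<xi> (min b 0)" "x (max a 0) - x (max b 0)"]
        by (simp add: dist_norm)
    qed
    ultimately show "\<exists>d>0. \<forall>\<phi>\<in>\<Phi>. \<forall>a\<in>{-\<theta>..T}. \<forall>b\<in>{-\<theta>..T}. \<bar>a - b\<bar> < d \<longrightarrow> norm (\<phi> a - \<phi> b) < e"
      by blast
  qed
  then show ?thesis by (simp add: \<Phi>_def)
qed

text \<open>The segments of the trajectory from \<open>\<xi>0\<close> with the same input lie in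
  \<open>K\<close>, and the tube lemma keeps both solutions within a fixed distance of it. There
  \<open>f\<close> has one Lipschitz constant, so Gronwall compares the two solutions directly. The
  constants depend on \<open>R\<close> and \<open>T\<close> but are common to all inputs bounded by
  \<open>R\<close>.\<close>

lemma flow_lipschitz:
  assumes rfc: "RFC \<theta> f" and \<xi>0: "\<xi>0 \<in> Xspace \<theta>" and T: "T > 0"
  obtains K \<delta> \<Lambda> where "K \<subseteq> Xspace \<theta>" "precompactX \<theta> K" "\<delta> > 0" "\<Lambda> > 0"
    "\<And>u x t. bounded_input R u \<Longrightarrow> sol_upto \<theta> f \<xi>0 u \<infinity> x \<Longrightarrow> t \<in> {0..T} \<Longrightarrow> seg \<theta> x t \<in> K"
    "\<And>u \<xi>1 \<xi>2 x1 x2 t. bounded_input R u \<Longrightarrow> \<xi>1 \<in> Xspace \<theta> \<Longrightarrow> \<xi>2 \<in> Xspace \<theta>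
      \<Longrightarrow> normX \<theta> (\<xi>1 - \<xi>0) < \<delta> \<Longrightarrow> normX \<theta> (\<xi>2 - \<xi>0) < \<delta>
      \<Longrightarrow> sol_upto \<theta> f \<xi>1 u \<infinity> x1 \<Longrightarrow> sol_upto \<theta> f \<xi>2 u \<infinity> x2 \<Longrightarrow> t \<in> {0..T}
      \<Longrightarrow> normX \<theta> (seg \<theta> x1 t - seg \<theta> x2 t) \<le> \<Lambda> * normX \<theta> (\<xi>1 - \<xi>2)"
proof -
  define K where "K = {seg \<theta> x t |x t. (\<exists>u. bounded_input R u \<and> sol_upto \<theta> f \<xi>0 u \<infinity> x) \<and> t \<in> {0..T}}"
  have cx: "continuous_on {-\<theta>..T} x" if "\<xi> \<in> Xspace \<theta>" "sol_upto \<theta> f \<xi> u \<infinity> x" for \<xi> u x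
    using sol_on_continuous[OF that(1) sol_upto_sol_on[OF that(2)]] .
  have K: "K \<subseteq> Xspace \<theta>" "precompactX \<theta> K"
    unfolding K_def using precompact_reachable[OF rfc \<xi>0 T] seg_in_Xspace cx[OF \<xi>0] by fast+
  then obtain \<delta> L where \<delta>: "\<delta> > 0" and L: "L > 0"
    and lip: "\<And>\<kappa> \<xi>1 \<xi>2 w. \<kappa> \<in> K \<Longrightarrow> \<xi>1 \<in> Xspace \<theta> \<Longrightarrow> \<xi>2 \<in> Xspace \<theta> \<Longrightarrow> normX \<theta> (\<xi>1 - \<kappa>) < \<delta>
      \<Longrightarrow> normX \<theta> (\<xi>2 - \<kappa>) < \<delta> \<Longrightarrow> norm w \<le> R \<Longrightarrow> norm (f \<xi>1 w - f \<xi>2 w) \<le> L * normX \<theta> (\<xi>1 - \<xi>2)"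
    by (rule lipschitz_near_precompact[where r = R]) blast
  define E where "E = exp (2 * L * T)"
  have E: "E > 0" by (simp add: E_def)
  \<comment> \<open>Closeness \<open>\<delta>'\<close> of the initial histories is exactly the
    smallness condition of \<open>solution_stays_in_tube\<close>.\<close>
  define \<delta>' where "\<delta>' = \<delta> / (4 * E)"
  have z: "normX \<theta> (\<eta> - \<eta>) = 0" for \<eta> :: "real \<Rightarrow> 'a"
    using delay_pos by (simp add: normX_diff_self)
  have inK: "seg \<theta> x t \<in> K" if "bounded_input R u" "sol_upto \<theta> f \<xi>0 u \<infinity> x" "t \<in> {0..T}" for u x t
    using that unfolding K_def by blast
  have tube: "normX \<theta> (seg \<theta> x t - seg \<theta> x0 t) < \<delta>"
    if u: "bounded_input R u" and \<xi>: "\<xi> \<in> Xspace \<theta>" "normX \<theta> (\<xi> - \<xi>0) < \<delta>'"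
      and x: "sol_upto \<theta> f \<xi> u \<infinity> x" and x0: "sol_upto \<theta> f \<xi>0 u \<infinity> x0" and t: "t \<in> {0..T}" for u \<xi> x x0 t
  proof -
    have "4 * exp (2 * L * T) * normX \<theta> (\<xi> - \<xi>0) < \<delta>"
      using \<xi>(2) E unfolding \<delta>'_def E_def[symmetric] by (simp add: field_simps)
    note stay = solution_stays_in_tube[where \<delta> = \<delta>, OF \<xi>0 \<xi>(1) sol_upto_sol_on[OF x0] sol_upto_sol_on[OF x] _ L _ this]
    have "norm (x s - x0 s) \<le> \<delta> / 2" if "s \<in> {-\<theta>..T}" for s
    proof (rule less_imp_le, rule stay[OF _ _ that])
      fix s \<eta> assume "s \<in> {0..T}" "\<eta> \<in> Xspace \<theta>" "normX \<theta> (\<eta> - seg \<theta> x0 s) < \<delta>"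
      then show "norm (f \<eta> (u s) - f (seg \<theta> x0 s) (u s)) \<le> L * normX \<theta> (\<eta> - seg \<theta> x0 s)"
        using u \<delta> seg_in_Xspace[OF cx[OF \<xi>0 x0]]
        by (intro lip[OF inK[OF u x0]]) (auto simp: z bounded_input_def)
    qed (use T in simp)
    then have "normX \<theta> (seg \<theta> x t - seg \<theta> x0 t) \<le> \<delta> / 2"
      by (rule seg_diff_le[OF _ t])
    then show ?thesis using \<delta> by simp
  qed
  have fc: "forward_complete \<theta> f" using rfc by (simp add: RFC_def)
  have est: "normX \<theta> (seg \<theta> x1 t - seg \<theta> x2 t) \<le> 2 * E * normX \<theta> (\<xi>1 - \<xi>2)"
    if u: "bounded_input R u" and \<xi>: "\<xi>1 \<in> Xspace \<theta>" "\<xi>2 \<in> Xspace \<theta>"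
      and near: "normX \<theta> (\<xi>1 - \<xi>0) < \<delta>'" "normX \<theta> (\<xi>2 - \<xi>0) < \<delta>'"
      and x: "sol_upto \<theta> f \<xi>1 u \<infinity> x1" "sol_upto \<theta> f \<xi>2 u \<infinity> x2" and t: "t \<in> {0..T}" for u \<xi>1 \<xi>2 x1 x2 t
  proof -
    obtain x0 where x0: "sol_upto \<theta> f \<xi>0 u \<infinity> x0" using global_solution[OF fc \<xi>0 u] .
    show ?thesis
    proof (rule seg_diff_le[OF _ t])
      fix s assume s: "s \<in> {-\<theta>..T}"
      show "norm (x1 s - x2 s) \<le> 2 * E * normX \<theta> (\<xi>1 - \<xi>2)"
        unfolding E_def
      proof (rule gronwall[OF \<xi> sol_upto_sol_on[OF x(1)] sol_upto_sol_on[OF x(2)] _ L _ s])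
        fix s assume s: "s \<in> {0..T}"
        show "norm (f (seg \<theta> x1 s) (u s) - f (seg \<theta> x2 s) (u s)) \<le> L * normX \<theta> (seg \<theta> x1 s - seg \<theta> x2 s)"
          using u by (intro lip[OF inK[OF u x0 s] seg_in_Xspace[OF cx[OF \<xi>(1) x(1)] s]
                seg_in_Xspace[OF cx[OF \<xi>(2) x(2)] s] tube[OF u \<xi>(1) near(1) x(1) x0 s]
                tube[OF u \<xi>(2) near(2) x(2) x0 s]]) (simp add: bounded_input_def)
      qed (use T in simp)
    qed
  qed
  show ?thesis
    by (rule that[OF K _ _ inK est]) (use \<delta> E in \<open>auto simp: \<delta>'_def\<close>)
qed

section \<open>Concatenation of trajectories\<close>

lemma concat_solution:
  assumes \<xi>: "\<xi> \<in> Xspace \<theta>" and u: "bounded_input r u" and x: "sol_upto \<theta> f \<xi> u \<infinity> x" and t: "t \<ge> 0"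
    and v: "bounded_input r v" and z: "sol_upto \<theta> f (seg \<theta> x t) v \<infinity> z"
  obtains u' w where "bounded_input r u'" "sol_upto \<theta> f \<xi> u' \<infinity> w"
    "\<And>\<tau>. \<tau> \<ge> 0 \<Longrightarrow> seg \<theta> w (t + \<tau>) = seg \<theta> z \<tau>"
proof -
  define u' where "u' s = (if s < t then u s else v (s - t))" for s
  define w where "w s = (if s \<le> t then x s else z (s - t))" for s
  have cx: "continuous_on {-\<theta>..T} x" for T
    using sol_on_continuous[OF \<xi> sol_upto_sol_on[OF x]] .
  have \<eta>: "seg \<theta> x t \<in> Xspace \<theta>" using seg_in_Xspace[OF cx, of t t] t by simp
  have cz: "continuous_on {-\<theta>..T} z" for T
    using sol_on_continuous[OF \<eta> sol_upto_sol_on[OF z]] .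
  \<comment> \<open>The two formulas for \<open>w\<close> agree from \<open>t - \<theta>\<close> on,
    because \<open>z\<close> starts with the segment of \<open>x\<close>; segments of
    \<open>w\<close> at times from \<open>t\<close> on are therefore segments of
    \<open>z\<close>.\<close>
  have wz: "w s = z (s - t)" if "s \<ge> t - \<theta>" for s
    using sol_on_initial[OF sol_upto_sol_on[OF z], of "s - t"] that by (auto simp: w_def seg_apply)
  have segz: "seg \<theta> w s = seg \<theta> z (s - t)" if "s \<ge> t" for s
    using that wz[of "s + _"] by (auto simp: seg_def fun_eq_iff algebra_simps)
  have segx: "seg \<theta> w s = seg \<theta> x s" if "s \<le> t" for s
    using that by (intro seg_cong) (auto simp: w_def)
  have [measurable]: "u \<in> borel_measurable borel" "v \<in> borel_measurable borel"
    using u v by (auto simp: bounded_input_def)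
  have "u' \<in> borel_measurable borel"
    unfolding u'_def by measurable
  then have u': "bounded_input r u'" using u v by (auto simp: bounded_input_def u'_def)
  have sol: "sol_on \<theta> f \<xi> u' T w" if T: "T \<ge> t" for T
  proof -
    have "continuous_on {-\<theta>..t} w"
      by (rule continuous_on_eq[OF cx]) (simp add: w_def)
    moreover have "continuous_on {t..T} w"
    proof (rule continuous_on_eq)
      show "continuous_on {t..T} (\<lambda>s. z (s - t))"
      proof (rule continuous_on_compose2[OF cz])
        show "continuous_on {t..T} (\<lambda>s. s - t)" by (intro continuous_intros)
      qed (use delay_pos in auto)
    qed (use wz delay_pos in auto)
    ultimately have "continuous_on ({-\<theta>..t} \<union> {t..T}) w"
      by (intro continuous_on_closed_Un) auto
    moreover have "{-\<theta>..t} \<union> {t..T} = {-\<theta>..T}" using t T delay_pos by auto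
    ultimately have cw: "continuous_on {-\<theta>..T} w" by simp
    define g where "g s = f (seg \<theta> w s) (u' s)" for s
    have gint: "g absolutely_integrable_on {0..T}"
      unfolding g_def[abs_def] using t T by (intro rhs_absolutely_integrable[OF cw _ u']) auto
    have first: "w s = \<xi> 0 + integral {0..s} g" if s: "s \<in> {0..t}" for s
    proof -
      have "w s = x s" using s by (simp add: w_def)
      also have "\<dots> = \<xi> 0 + integral {0..s} (\<lambda>\<sigma>. f (seg \<theta> x \<sigma>) (u \<sigma>))"
        using sol_upto_sol_on[OF x, of t] s by (simp add: sol_on_def)
      \<comment> \<open>At the switching time \<open>u'\<close> already takes its value from
        \<open>v\<close>; the single point \<open>t\<close> is negligible.\<close>
      also have "integral {0..s} (\<lambda>\<sigma>. f (seg \<theta> x \<sigma>) (u \<sigma>)) = integral {0..s} g"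
        by (rule integral_spike[of "{t}"]) (use s in \<open>auto simp: g_def u'_def segx\<close>)
      finally show ?thesis .
    qed
    have second: "w s = \<xi> 0 + integral {0..s} g" if s: "s \<in> {t..T}" for s
    proof -
      have "w s = z (s - t)" using s wz delay_pos by simp
      also have "\<dots> = seg \<theta> x t 0 + integral {0..s - t} (\<lambda>\<sigma>. f (seg \<theta> z \<sigma>) (v \<sigma>))"
        using sol_upto_sol_on[OF z, of "s - t"] s by (simp add: sol_on_def)
      also have "integral {0..s - t} (\<lambda>\<sigma>. f (seg \<theta> z \<sigma>) (v \<sigma>)) = integral {0..s - t} (\<lambda>\<sigma>. g (\<sigma> + t))"
        by (rule integral_cong) (simp add: g_def u'_def segz)
      also have "\<dots> = integral {t..s} g"
        using integral_shift_real_ivl[where a = t and b = s and c = t and f = g] by simp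
      also have "seg \<theta> x t 0 = \<xi> 0 + integral {0..t} g"
        using first[of t] t delay_pos by (simp add: seg_apply w_def)
      also have "\<xi> 0 + integral {0..t} g + integral {t..s} g = \<xi> 0 + integral {0..s} g"
      proof -
        have "g integrable_on {0..s}"
          by (rule integrable_subinterval_real[of _ 0 T])
            (use gint s t in \<open>auto simp: absolutely_integrable_on_def\<close>)
        then show ?thesis using Henstock_Kurzweil_Integration.integral_combine[of 0 t s g] s t by (simp add: algebra_simps)
      qed
      finally show ?thesis .
    qed
    show ?thesis
      unfolding sol_on_def
    proof (intro conjI ballI)
      show "w s = \<xi> s" if "s \<in> {-\<theta>..0}" for s
        using sol_on_initial[OF sol_upto_sol_on[OF x] that] that t by (simp add: w_def)
      show "w s = \<xi> 0 + integral {0..s} (\<lambda>s. f (seg \<theta> w s) (u' s))" if "s \<in> {0..T}" for s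
        using first[of s] second[of s] that unfolding g_def[abs_def] by fastforce
    qed (use gint in \<open>simp add: g_def[abs_def]\<close>)
  qed
  have "sol_upto \<theta> f \<xi> u' \<infinity> w"
    unfolding sol_upto_def
  proof (intro conjI allI impI)
    show "sol_on \<theta> f \<xi> u' T w" for T
      by (rule sol_on_mono[OF sol[of "max t T"]]) auto
  qed simp
  moreover have "seg \<theta> w (t + \<tau>) = seg \<theta> z \<tau>" if "\<tau> \<ge> 0" for \<tau>
    using segz[of "t + \<tau>"] that by simp
  ultimately show ?thesis using that u' by blast
qed

end

section \<open>Comparison functions\<close>

lemma classN_nonneg: "classN \<sigma> \<Longrightarrow> s \<ge> 0 \<Longrightarrow> \<sigma> s \<ge> 0"
  by (simp add: classN_def)

lemma classN_mono: "classN \<sigma> \<Longrightarrow> 0 \<le> s \<Longrightarrow> s \<le> s' \<Longrightarrow> \<sigma> s \<le> \<sigma> s'"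
  unfolding classN_def mono_on_def by simp

lemma classKL_classN: "classKL \<beta> \<Longrightarrow> t \<ge> 0 \<Longrightarrow> classN (\<lambda>s. \<beta> s t)"
  by (simp add: classKL_def classK_def)

lemma classKL_antimono: "classKL \<beta> \<Longrightarrow> s \<ge> 0 \<Longrightarrow> 0 \<le> t \<Longrightarrow> t \<le> t' \<Longrightarrow> \<beta> s t' \<le> \<beta> s t"
  unfolding classKL_def monotone_on_def by simp

lemma classN_add:
  assumes "classN \<sigma>" "classN \<tau>"
  shows "classN (\<lambda>s. \<sigma> s + \<tau> s)"
  using assms unfolding classN_def mono_on_def by (auto intro!: continuous_intros add_mono)

lemma classN_cmult:
  assumes "classN \<sigma>" "c \<ge> 0"
  shows "classN (\<lambda>s. c * \<sigma> s)"
  using assms unfolding classN_def mono_on_def by (auto intro!: continuous_intros mult_left_mono)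

lemma classKinf_ident: "classKinf (\<lambda>s. s)"
  unfolding classKinf_def classK_def classN_def mono_on_def strict_mono_on_def by auto

lemma classN_ident: "classN (\<lambda>s. s)"
  using classKinf_ident unfolding classKinf_def classK_def by blast

text \<open>A function of class N may be bounded and constant on intervals; adding the identity
  cures both.\<close>

lemma classKinf_add_ident:
  assumes "classN \<sigma>"
  shows "classKinf (\<lambda>s. \<sigma> s + s)"
  unfolding classKinf_def classK_def
proof (intro conjI allI impI)
  show N: "classN (\<lambda>s. \<sigma> s + s)" by (intro classN_add assms classN_ident)
  show "strict_mono_on {0..} (\<lambda>s. \<sigma> s + s)"
    using classN_mono[OF assms] by (auto simp: strict_mono_on_def intro!: add_le_less_mono)
  fix r :: real assume "r \<ge> 0"
  have "continuous_on {0..r} (\<lambda>s. \<sigma> s + s)"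
    by (rule continuous_on_subset[of "{0..}"]) (use N in \<open>auto simp: classN_def\<close>)
  moreover have "\<sigma> 0 + 0 \<le> r" "r \<le> \<sigma> r + r"
    using \<open>r \<ge> 0\<close> assms classN_nonneg[OF assms] by (auto simp: classN_def)
  ultimately show "\<exists>s\<ge>0. \<sigma> s + s = r"
    using IVT'[of "\<lambda>s. \<sigma> s + s" 0 r r] \<open>r \<ge> 0\<close> by auto
qed

lemma classKinf_inverse:
  assumes "classKinf \<alpha>"
  obtains g where "classK g" "\<And>s. s \<ge> 0 \<Longrightarrow> g (\<alpha> s) = s"
proof -
  have \<alpha>: "\<alpha> 0 = 0" "\<And>s. s \<ge> 0 \<Longrightarrow> \<alpha> s \<ge> 0" "strict_mono_on {0..} \<alpha>" "\<And>r. r \<ge> 0 \<Longrightarrow> \<exists>s\<ge>0. \<alpha> s = r"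
    using assms by (auto simp: classKinf_def classK_def classN_def)
  \<comment> \<open>Continued by the identity to negative arguments, \<open>\<alpha>\<close> becomes
    an increasing bijection of the line, and its inverse is continuous as a monotone
    surjection.\<close>
  define A where "A x = (if x \<ge> 0 then \<alpha> x else x)" for x
  have A: "strict_mono A"
  proof (rule strict_monoI)
    fix x y :: real assume "x < y"
    then show "A x < A y"
      using \<alpha>(2)[of y] \<alpha>(3) by (auto simp: A_def strict_mono_on_def)
  qed
  have "surj A"
    unfolding surj_def
  proof
    show "\<exists>x. r = A x" for r
      using \<alpha>(4)[of r] by (cases "r \<ge> 0") (auto simp: A_def)
  qed
  define g where "g = inv A"
  have gA: "g (A x) = x" for x
    unfolding g_def using strict_mono_imp_inj_on[OF A] by simp
  have Ag: "A (g y) = y" for y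
    unfolding g_def using \<open>surj A\<close> by (simp add: surj_f_inv_f)
  have less: "g x < g y \<longleftrightarrow> x < y" for x y
    using strict_mono_less[OF A, of "g x" "g y"] by (simp add: Ag)
  have g0: "g 0 = 0" using gA[of 0] \<alpha>(1) by (simp add: A_def)
  have mono: "g x \<le> g y" if "x \<le> y" for x y using less[of y x] that by linarith
  have "range g = UNIV" using gA by (metis surjI)
  then have cont: "continuous_on UNIV g"
    by (intro continuous_onI_mono) (simp_all add: mono)
  have "classK g"
    unfolding classK_def classN_def
    using g0 mono less mono[of 0] continuous_on_subset[OF cont]
    by (auto simp: mono_on_def strict_mono_on_def)
  moreover have "g (\<alpha> s) = s" if "s \<ge> 0" for s
    using gA[of s] that by (simp add: A_def)
  ultimately show ?thesis using that by blast
qed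

lemma classK_compose:
  assumes "classK \<sigma>" "classK \<tau>"
  shows "classK (\<lambda>s. \<sigma> (\<tau> s))"
proof -
  have "continuous_on {0..} (\<lambda>s. \<sigma> (\<tau> s))"
    using assms by (intro continuous_on_compose2[of "{0..}" \<sigma> _ \<tau>]) (auto simp: classK_def classN_def)
  then show ?thesis
    using assms unfolding classK_def classN_def mono_on_def strict_mono_on_def by auto
qed

lemma classN_compose:
  assumes "classN \<sigma>" "classN \<tau>"
  shows "classN (\<lambda>s. \<sigma> (\<tau> s))"
proof -
  have "continuous_on {0..} (\<lambda>s. \<sigma> (\<tau> s))"
    using assms by (intro continuous_on_compose2[of "{0..}" \<sigma> _ \<tau>]) (auto simp: classN_def)
  then show ?thesis
    using assms unfolding classN_def mono_on_def by auto
qed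

lemma classK_cmult:
  assumes "classK \<sigma>" "c > 0"
  shows "classK (\<lambda>s. c * \<sigma> s)"
  using assms classN_cmult[of \<sigma> c] unfolding classK_def strict_mono_on_def by auto

lemma classKL_compose:
  assumes g: "classK g" and \<beta>: "classKL \<beta>" and c: "c > 0"
  shows "classKL (\<lambda>s t. g (c * \<beta> s t))"
  unfolding classKL_def
proof (intro conjI allI impI)
  show "classK (\<lambda>s. g (c * \<beta> s t))" if "t \<ge> 0" for t
    using \<beta> that by (intro classK_compose[OF g] classK_cmult c) (simp add: classKL_def)
  fix s :: real assume s: "s \<ge> 0"
  have gN: "classN g" using g by (simp add: classK_def)
  have nn: "0 \<le> c * \<beta> s t" if "t \<ge> 0" for t
    using classN_nonneg[OF classKL_classN[OF \<beta> that] s] c by simp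
  show "antimono_on {0..} (\<lambda>t. g (c * \<beta> s t))"
    unfolding monotone_on_def
    using nn c classKL_antimono[OF \<beta> s] by (auto intro!: classN_mono[OF gN] mult_left_mono)
  have "((\<lambda>t. c * \<beta> s t) \<longlongrightarrow> c * 0) at_top"
    using \<beta> s by (intro tendsto_intros) (simp add: classKL_def)
  moreover have "\<forall>\<^sub>F t in at_top. c * \<beta> s t \<in> {0..}"
    using eventually_ge_at_top[of 0] by eventually_elim (use nn in simp)
  ultimately have "((\<lambda>t. g (c * \<beta> s t)) \<longlongrightarrow> g 0) at_top"
    using gN by (intro continuous_on_tendsto_compose[of "{0..}" g]) (auto simp: classN_def)
  then show "((\<lambda>t. g (c * \<beta> s t)) \<longlongrightarrow> 0) at_top"
    using gN by (simp add: classN_def)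
qed

section \<open>From the redefined output back to the original one\<close>

text \<open>An inverse \<open>g\<close> of the lower comparison function recovers the norm of
  \<open>h\<close>. As \<open>g\<close> need not be subadditive, the sum of the two bounds is
  replaced by the maximum of their doubles, whence the factors 2.\<close>

lemma IOS_of_output_redef:
  assumes "\<theta> \<ge> 0" and cont: "\<And>x u \<xi> t. \<xi> \<in> Xspace \<theta> \<Longrightarrow> sol_upto \<theta> f \<xi> u \<infinity> x \<Longrightarrow> t \<ge> 0 \<Longrightarrow> seg \<theta> x t \<in> Xspace \<theta>"
    and redef: "output_redef \<theta> h hb" and ios: "IOS \<theta> f hb"
  shows "IOS \<theta> f h"
proof -
  obtain \<alpha> where \<alpha>: "classKinf \<alpha>" "\<And>\<xi>. \<xi> \<in> Xspace \<theta> \<Longrightarrow> \<alpha> (norm (h \<xi>)) \<le> \<bar>hb \<xi>\<bar>"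
    using redef unfolding output_redef_def by blast
  obtain g where g: "classK g" "\<And>s. s \<ge> 0 \<Longrightarrow> g (\<alpha> s) = s" by (rule classKinf_inverse[OF \<alpha>(1)]) blast
  obtain \<beta> \<gamma> where \<beta>: "classKL \<beta>" and \<gamma>: "classN \<gamma>" and
    est: "\<forall>\<xi>\<in>Xspace \<theta>. \<forall>u\<in>inputs. \<forall>x. sol_upto \<theta> f \<xi> u \<infinity> x \<and> normU u < \<infinity> \<longrightarrow>
           (\<forall>t\<ge>0. norm (hb (seg \<theta> x t)) \<le> \<beta> (normX \<theta> \<xi>) t + \<gamma> (real_of_ereal (normU u)))"
    using ios unfolding IOS_def by blast
  have gN: "classN g" using g by (simp add: classK_def)
  have "norm (h (seg \<theta> x t)) \<le> g (2 * \<beta> (normX \<theta> \<xi>) t) + g (2 * \<gamma> (real_of_ereal (normU u)))"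
    if "\<xi> \<in> Xspace \<theta>" "u \<in> inputs" "sol_upto \<theta> f \<xi> u \<infinity> x \<and> normU u < \<infinity>" "t \<ge> 0" for \<xi> u x t
  proof -
    define a where "a = \<beta> (normX \<theta> \<xi>) t"
    define b where "b = \<gamma> (real_of_ereal (normU u))"
    have ab: "a \<ge> 0" "b \<ge> 0"
      unfolding a_def b_def
      using classN_nonneg[OF classKL_classN[OF \<beta> that(4)]] classN_nonneg[OF \<gamma>] normX_nonneg[OF assms(1) that(1)] normU_nonneg[of u]
      by (auto simp: real_of_ereal_pos)
    have seg: "seg \<theta> x t \<in> Xspace \<theta>" using cont that by blast
    have "\<alpha> (norm (h (seg \<theta> x t))) \<le> a + b"
      using \<alpha>(2)[OF seg] est that unfolding a_def b_def by fastforce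
    also have "\<dots> \<le> max (2 * a) (2 * b)" by linarith
    finally have le: "\<alpha> (norm (h (seg \<theta> x t))) \<le> max (2 * a) (2 * b)" .
    have "norm (h (seg \<theta> x t)) = g (\<alpha> (norm (h (seg \<theta> x t))))" using g(2) by simp
    also have "\<dots> \<le> g (max (2 * a) (2 * b))"
      using \<alpha>(1) le by (intro classN_mono[OF gN]) (auto simp: classKinf_def classK_def classN_def)
    also have "\<dots> \<le> g (2 * a) + g (2 * b)"
      using classN_nonneg[OF gN, of "2 * a"] classN_nonneg[OF gN, of "2 * b"] ab by (auto simp: max_def)
    finally show ?thesis by (simp add: a_def b_def)
  qed
  moreover have "classKL (\<lambda>s t. g (2 * \<beta> s t))" using g \<beta> by (intro classKL_compose) auto
  moreover have "classN (\<lambda>s. g (2 * \<gamma> s))" using gN \<gamma> by (intro classN_compose[OF gN] classN_cmult) auto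
  moreover have "forward_complete \<theta> f" using ios by (simp add: IOS_def)
  ultimately show ?thesis unfolding IOS_def by blast
qed

section \<open>The redefined output\<close>

locale ios_system = delay_system \<theta> f
  for \<theta> and f :: "(real \<Rightarrow> 'a::euclidean_space) \<Rightarrow> 'b::euclidean_space \<Rightarrow> 'a" +
  fixes h :: "(real \<Rightarrow> 'a) \<Rightarrow> 'c::real_normed_vector" and \<beta> \<gamma>
  assumes rfc: "RFC \<theta> f"
    and cont_h: "continuous_X \<theta> h"
    and \<beta>: "classKL \<beta>" and \<gamma>: "classN \<gamma>"
    and est: "\<And>\<xi> u x t. \<xi> \<in> Xspace \<theta> \<Longrightarrow> u \<in> inputs \<Longrightarrow> sol_upto \<theta> f \<xi> u \<infinity> x \<Longrightarrow> normU u < \<infinity> \<Longrightarrow> t \<ge> 0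
      \<Longrightarrow> norm (h (seg \<theta> x t)) \<le> \<beta> (normX \<theta> \<xi>) t + \<gamma> (real_of_ereal (normU u))"
begin

lemma complete_flow: "forward_complete \<theta> f"
  using rfc by (simp add: RFC_def)

text \<open>The summand \<open>r\<close> makes the gain unbounded, so that large inputs do not contribute to \<open>V\<close> below.\<close>

definition gain :: "real \<Rightarrow> real" where
  "gain r = \<gamma> r + r"

lemma gain: "classN gain" "gain 0 = 0"
proof -
  show "classN gain"
    unfolding gain_def[abs_def] by (intro classN_add \<gamma> classN_ident)
  then show "gain 0 = 0" by (simp add: classN_def)
qed

text \<open>Here \<open>r\<close> is any bound of the input and not its norm; since
  \<open>gain\<close> is nondecreasing, a larger bound only lowers the value, and concatenated
  inputs can be given a common bound. The element 0 realises the maximum with 0 and makes the set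
  nonempty.\<close>

definition excess :: "(real \<Rightarrow> 'a) \<Rightarrow> real set" where
  "excess \<xi> = insert 0 {norm (h (seg \<theta> x t)) - gain r |r u x t.
     r \<ge> 0 \<and> bounded_input r u \<and> sol_upto \<theta> f \<xi> u \<infinity> x \<and> t \<ge> 0}"

definition V :: "(real \<Rightarrow> 'a) \<Rightarrow> real" where
  "V \<xi> = Sup (excess \<xi>)"

lemma est_bounded:
  assumes "\<xi> \<in> Xspace \<theta>" "bounded_input r u" "sol_upto \<theta> f \<xi> u \<infinity> x" "t \<ge> 0"
  shows "norm (h (seg \<theta> x t)) \<le> \<beta> (normX \<theta> \<xi>) t + \<gamma> r"
proof -
  have u: "u \<in> inputs" "normU u \<le> ereal r" using bounded_input_in_inputs[OF assms(2)] by auto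
  then have "normU u < \<infinity>" by auto
  have "real_of_ereal (normU u) \<le> r" "0 \<le> real_of_ereal (normU u)"
    using u normU_nonneg[of u] by (cases "normU u"; auto)+
  then have "\<gamma> (real_of_ereal (normU u)) \<le> \<gamma> r" by (intro classN_mono[OF \<gamma>])
  with est[OF assms(1) u(1) assms(3) \<open>normU u < \<infinity>\<close> assms(4)] show ?thesis by linarith
qed

lemma \<beta>_nonneg: "\<xi> \<in> Xspace \<theta> \<Longrightarrow> t \<ge> 0 \<Longrightarrow> \<beta> (normX \<theta> \<xi>) t \<ge> 0"
  using delay_pos by (intro classN_nonneg[OF classKL_classN[OF \<beta>]] normX_nonneg) auto

text \<open>The input term \<open>\<gamma> r\<close> of the IOS estimate is absorbed by
  \<open>gain r\<close>. This bound is what makes the supremum \<open>V\<close> finite.\<close>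

lemma excess_le:
  assumes \<xi>: "\<xi> \<in> Xspace \<theta>" and w: "w \<in> excess \<xi>"
  shows "w \<le> \<beta> (normX \<theta> \<xi>) 0"
proof (cases "w = 0")
  case False
  with w obtain r u x t where *: "w = norm (h (seg \<theta> x t)) - gain r" "r \<ge> 0" "bounded_input r u"
    "sol_upto \<theta> f \<xi> u \<infinity> x" "t \<ge> 0" unfolding excess_def by blast
  have "\<beta> (normX \<theta> \<xi>) t \<le> \<beta> (normX \<theta> \<xi>) 0"
    using * \<xi> delay_pos by (intro classKL_antimono[OF \<beta>] normX_nonneg) auto
  then show ?thesis using est_bounded[OF \<xi> *(3-5)] * by (simp add: gain_def)
qed (use \<beta>_nonneg \<xi> in auto)

lemma excess_bdd: "\<xi> \<in> Xspace \<theta> \<Longrightarrow> bdd_above (excess \<xi>)"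
  using excess_le by (rule bdd_aboveI)

lemma V_upper: "\<xi> \<in> Xspace \<theta> \<Longrightarrow> w \<in> excess \<xi> \<Longrightarrow> w \<le> V \<xi>"
  unfolding V_def by (intro cSup_upper excess_bdd)

lemma V_leI: "(\<And>w. w \<in> excess \<xi> \<Longrightarrow> w \<le> c) \<Longrightarrow> V \<xi> \<le> c"
  unfolding V_def by (rule cSup_least) (auto simp: excess_def)

lemma V_nonneg: "\<xi> \<in> Xspace \<theta> \<Longrightarrow> 0 \<le> V \<xi>"
  by (rule V_upper) (auto simp: excess_def)

lemma V_le: "\<xi> \<in> Xspace \<theta> \<Longrightarrow> V \<xi> \<le> \<beta> (normX \<theta> \<xi>) 0"
  by (intro V_leI excess_le)

lemma norm_le_V:
  assumes "\<xi> \<in> Xspace \<theta>"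
  shows "norm (h \<xi>) \<le> V \<xi>"
proof -
  \<comment> \<open>The value at time 0 under the zero input carries the penalty
    \<open>gain 0 = 0\<close>.\<close>
  have u: "bounded_input 0 (\<lambda>_. 0 :: 'b)" by (simp add: bounded_input_def)
  obtain x where x: "sol_upto \<theta> f \<xi> (\<lambda>_. 0) \<infinity> x" using global_solution[OF complete_flow assms u] .
  have "seg \<theta> x 0 = \<xi>"
    using seg_0[OF assms, of x] sol_on_initial[OF sol_upto_sol_on[OF x]] by simp
  then have "norm (h \<xi>) \<in> excess \<xi>"
    unfolding excess_def using u x gain(2) by force
  then show ?thesis by (rule V_upper[OF assms])
qed

text \<open>A trajectory from the segment at \<open>t\<close> with input bound \<open>r'\<close>
  extends \<open>x\<close> to one from \<open>\<xi>\<close> with bound \<open>max r r'\<close>,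
  whose gain is at most \<open>gain r + gain r'\<close>. The part \<open>gain r'\<close> is already
  deducted in \<open>V (seg \<theta> x t)\<close>, so \<open>gain r\<close> remains. The second
  bound is the IOS estimate of the extended trajectory at time \<open>t + \<tau>\<close>, with
  \<open>\<beta>\<close> nonincreasing in time.\<close>

lemma V_along_solution:
  assumes \<xi>: "\<xi> \<in> Xspace \<theta>" and u: "u \<in> inputs" and x: "sol_upto \<theta> f \<xi> u \<infinity> x" and fin: "normU u < \<infinity>" and t: "t \<ge> 0"
  shows "V (seg \<theta> x t) \<le> V \<xi> + gain (real_of_ereal (normU u))"
    and "V (seg \<theta> x t) \<le> \<beta> (normX \<theta> \<xi>) t + gain (real_of_ereal (normU u))"
proof -
  define r where "r = real_of_ereal (normU u)"
  have r: "normU u = ereal r" "r \<ge> 0"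
    using fin normU_nonneg[of u] by (cases "normU u"; auto simp: r_def)+
  \<comment> \<open>\<open>excess\<close> admits everywhere bounded inputs; the representative has
    the same solution \<open>x\<close>.\<close>
  obtain u0 N where u0: "bounded_input r u0" and N: "negligible N" "\<And>t. t \<ge> 0 \<Longrightarrow> t \<notin> N \<Longrightarrow> u0 t = u t"
    by (rule bounded_input_representative[OF u r(1)]) blast
  have x0: "sol_upto \<theta> f \<xi> u0 \<infinity> x"
    using x unfolding sol_upto_def by (auto intro: sol_on_cong_input[OF _ N(1)] simp: N(2))
  have "w \<le> V \<xi> + gain r \<and> w \<le> \<beta> (normX \<theta> \<xi>) t + gain r" if w: "w \<in> excess (seg \<theta> x t)" for w
  proof (cases "w = 0")
    case True
    then show ?thesis
      using V_nonneg[OF \<xi>] \<beta>_nonneg[OF \<xi> t] classN_nonneg[OF gain(1) r(2)] by simp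
  next
    case False
    with w obtain r' v z \<tau> where *: "w = norm (h (seg \<theta> z \<tau>)) - gain r'" "r' \<ge> 0" "bounded_input r' v"
      "sol_upto \<theta> f (seg \<theta> x t) v \<infinity> z" "\<tau> \<ge> 0" unfolding excess_def by blast
    define m where "m = max r r'"
    have m: "bounded_input m u0" "bounded_input m v" "m \<ge> 0"
      using u0 *(2,3) by (auto intro: bounded_input_mono simp: m_def)
    obtain u' y where y: "bounded_input m u'" "sol_upto \<theta> f \<xi> u' \<infinity> y"
      "\<And>\<tau>. \<tau> \<ge> 0 \<Longrightarrow> seg \<theta> y (t + \<tau>) = seg \<theta> z \<tau>"
      using concat_solution[OF \<xi> m(1) x0 t m(2) *(4)] by blast
    have gm: "gain m \<le> gain r + gain r'" "\<gamma> m + 0 \<le> gain r + gain r'"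
      using classN_nonneg[OF gain(1)] classN_nonneg[OF \<gamma>] r(2) *(2) unfolding m_def
      by (auto simp: max_def gain_def)
    have "norm (h (seg \<theta> y (t + \<tau>))) - gain m \<in> excess \<xi>"
      unfolding excess_def using m(3) y(1,2) t *(5) by force
    then have "norm (h (seg \<theta> z \<tau>)) - gain m \<le> V \<xi>"
      using V_upper[OF \<xi>] y(3)[OF *(5)] by simp
    moreover have "norm (h (seg \<theta> z \<tau>)) \<le> \<beta> (normX \<theta> \<xi>) (t + \<tau>) + \<gamma> m"
      using est_bounded[OF \<xi> y(1,2), of "t + \<tau>"] y(3)[OF *(5)] t *(5) by simp
    moreover have "\<beta> (normX \<theta> \<xi>) (t + \<tau>) \<le> \<beta> (normX \<theta> \<xi>) t"
      using \<xi> t *(5) delay_pos by (intro classKL_antimono[OF \<beta>] normX_nonneg) auto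
    ultimately show ?thesis using gm *(1) by linarith
  qed
  then show "V (seg \<theta> x t) \<le> V \<xi> + gain (real_of_ereal (normU u))"
    and "V (seg \<theta> x t) \<le> \<beta> (normX \<theta> \<xi>) t + gain (real_of_ereal (normU u))"
    unfolding r_def[symmetric] by (auto intro: V_leI)
qed

text \<open>Only inputs bounded by \<open>\<beta> N 0\<close> and times before \<open>\<beta> N t\<close> has dropped below the threshold
  \<open>c\<close> contribute to values of \<open>V\<close> above \<open>c\<close>.\<close>

lemma V_compare:
  assumes \<xi>0: "\<xi>0 \<in> Xspace \<theta>" and c: "c > 0"
  obtains R T where "T > 0"
    "\<And>\<xi>1 \<xi>2 D. \<xi>1 \<in> Xspace \<theta> \<Longrightarrow> \<xi>2 \<in> Xspace \<theta> \<Longrightarrow> normX \<theta> (\<xi>1 - \<xi>0) < 1 \<Longrightarrow> D \<ge> 0 \<Longrightarrow>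
      (\<And>u x1 x2 t. bounded_input R u \<Longrightarrow> sol_upto \<theta> f \<xi>1 u \<infinity> x1 \<Longrightarrow> sol_upto \<theta> f \<xi>2 u \<infinity> x2 \<Longrightarrow> t \<in> {0..T}
        \<Longrightarrow> norm (h (seg \<theta> x1 t)) \<le> norm (h (seg \<theta> x2 t)) + D) \<Longrightarrow> V \<xi>1 \<le> max c (V \<xi>2 + D)"
proof -
  \<comment> \<open>\<open>N\<close> bounds every history within distance 1 of
    \<open>\<xi>0\<close>, so \<open>T\<close> and \<open>R\<close> serve the whole
    neighbourhood.\<close>
  define N where "N = normX \<theta> \<xi>0 + 1"
  have "N \<ge> 0" using normX_nonneg[OF _ \<xi>0] delay_pos by (simp add: N_def)
  have "((\<beta> N) \<longlongrightarrow> 0) at_top" using \<beta> \<open>N \<ge> 0\<close> by (simp add: classKL_def)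
  then have "\<forall>\<^sub>F t in at_top. \<beta> N t < c" using c by (rule order_tendstoD(2))
  then obtain T0 where T0: "\<And>t. t \<ge> T0 \<Longrightarrow> \<beta> N t < c" unfolding eventually_at_top_linorder by blast
  define T where "T = max T0 1"
  define R where "R = \<beta> N 0"
  show ?thesis
  proof (rule that)
    show "T > 0" by (simp add: T_def)
    fix \<xi>1 \<xi>2 D
    assume \<xi>: "\<xi>1 \<in> Xspace \<theta>" "\<xi>2 \<in> Xspace \<theta>" and near: "normX \<theta> (\<xi>1 - \<xi>0) < 1" and D: "D \<ge> 0"
      and cmp: "\<And>u x1 x2 t. bounded_input R u \<Longrightarrow> sol_upto \<theta> f \<xi>1 u \<infinity> x1 \<Longrightarrow> sol_upto \<theta> f \<xi>2 u \<infinity> x2 \<Longrightarrow> t \<in> {0..T}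
        \<Longrightarrow> norm (h (seg \<theta> x1 t)) \<le> norm (h (seg \<theta> x2 t)) + D"
    have N1: "normX \<theta> \<xi>1 \<le> N" "0 \<le> normX \<theta> \<xi>1"
      using normX_le_add[OF _ \<xi>(1) \<xi>0] near delay_pos normX_nonneg[OF _ \<xi>(1)] by (auto simp: N_def)
    show "V \<xi>1 \<le> max c (V \<xi>2 + D)"
    proof (rule V_leI, rule ccontr)
      fix w assume w: "w \<in> excess \<xi>1" "\<not> w \<le> max c (V \<xi>2 + D)"
      then have "w > c" "w > V \<xi>2 + D" by auto
      then have "w \<noteq> 0" using c by simp
      with w(1) obtain r u x t where *: "w = norm (h (seg \<theta> x t)) - gain r" "r \<ge> 0" "bounded_input r u"
        "sol_upto \<theta> f \<xi>1 u \<infinity> x" "t \<ge> 0" unfolding excess_def by blast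
      have "\<beta> (normX \<theta> \<xi>1) t \<le> \<beta> N t"
        by (intro classN_mono[OF classKL_classN[OF \<beta> *(5)]] N1)
      \<comment> \<open>The summand \<open>r\<close> of the gain is what survives here:
        \<open>w > c\<close> now forces both \<open>\<beta> N t > c\<close> and
        \<open>r < \<beta> N t\<close>.\<close>
      then have w': "w \<le> \<beta> N t - r"
        using est_bounded[OF \<xi>(1) *(3-5)] *(1) by (simp add: gain_def)
      then have "t < T0" using T0[of t] \<open>w > c\<close> *(2) by fastforce
      then have t: "t \<in> {0..T}" using *(5) by (simp add: T_def)
      have "\<beta> N t \<le> \<beta> N 0" by (intro classKL_antimono[OF \<beta>] \<open>N \<ge> 0\<close> *(5)) simp
      then have "r \<le> R" using w' \<open>w > c\<close> c by (simp add: R_def)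
      then have u: "bounded_input R u" using *(3) bounded_input_mono by blast
      \<comment> \<open>The same input and the same \<open>r\<close> are used from
        \<open>\<xi>2\<close>, so the gains cancel in the comparison.\<close>
      obtain x2 where x2: "sol_upto \<theta> f \<xi>2 u \<infinity> x2" using global_solution[OF complete_flow \<xi>(2) u] .
      have "norm (h (seg \<theta> x2 t)) - gain r \<in> excess \<xi>2"
        unfolding excess_def using * x2 by blast
      then have "norm (h (seg \<theta> x2 t)) - gain r \<le> V \<xi>2" by (rule V_upper[OF \<xi>(2)])
      then show False using cmp[OF u *(4) x2 t] *(1) \<open>w > V \<xi>2 + D\<close> by linarith
    qed
  qed
qed

section \<open>Continuity and Lipschitz property of the redefined output\<close>

text \<open>The threshold \<open>e / 2\<close> costs nothing: \<open>V\<close> is nonnegative, so it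
  never exceeds \<open>V \<xi>0 + e / 2\<close>. Continuity thus holds also where \<open>V\<close>
  vanishes.\<close>

lemma V_continuous: "continuous_X \<theta> V"
  unfolding continuous_X_def
proof (intro ballI allI impI)
  fix \<xi>0 :: "real \<Rightarrow> 'a" and e :: real assume \<xi>0: "\<xi>0 \<in> Xspace \<theta>" and e: "e > 0"
  obtain R T where T: "T > 0" and cmp: "\<And>\<xi>1 \<xi>2 D. \<xi>1 \<in> Xspace \<theta> \<Longrightarrow> \<xi>2 \<in> Xspace \<theta> \<Longrightarrow> normX \<theta> (\<xi>1 - \<xi>0) < 1 \<Longrightarrow> D \<ge> 0 \<Longrightarrow>
      (\<And>u x1 x2 t. bounded_input R u \<Longrightarrow> sol_upto \<theta> f \<xi>1 u \<infinity> x1 \<Longrightarrow> sol_upto \<theta> f \<xi>2 u \<infinity> x2 \<Longrightarrow> t \<in> {0..T}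
        \<Longrightarrow> norm (h (seg \<theta> x1 t)) \<le> norm (h (seg \<theta> x2 t)) + D) \<Longrightarrow> V \<xi>1 \<le> max (e / 2) (V \<xi>2 + D)"
    using V_compare[OF \<xi>0, of "e / 2"] e by (metis half_gt_zero)
  obtain K \<delta> \<Lambda> where K: "K \<subseteq> Xspace \<theta>" "precompactX \<theta> K" and \<delta>: "\<delta> > 0" and \<Lambda>: "\<Lambda> > 0"
    and inK: "\<And>u x t. bounded_input R u \<Longrightarrow> sol_upto \<theta> f \<xi>0 u \<infinity> x \<Longrightarrow> t \<in> {0..T} \<Longrightarrow> seg \<theta> x t \<in> K"
    and flow: "\<And>u \<xi>1 \<xi>2 x1 x2 t. bounded_input R u \<Longrightarrow> \<xi>1 \<in> Xspace \<theta> \<Longrightarrow> \<xi>2 \<in> Xspace \<theta>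
      \<Longrightarrow> normX \<theta> (\<xi>1 - \<xi>0) < \<delta> \<Longrightarrow> normX \<theta> (\<xi>2 - \<xi>0) < \<delta>
      \<Longrightarrow> sol_upto \<theta> f \<xi>1 u \<infinity> x1 \<Longrightarrow> sol_upto \<theta> f \<xi>2 u \<infinity> x2 \<Longrightarrow> t \<in> {0..T}
      \<Longrightarrow> normX \<theta> (seg \<theta> x1 t - seg \<theta> x2 t) \<le> \<Lambda> * normX \<theta> (\<xi>1 - \<xi>2)"
    by (rule flow_lipschitz[OF rfc \<xi>0 T, where R = R]) blast
  obtain \<rho> where \<rho>: "\<rho> > 0" "\<And>\<kappa> \<eta>. \<kappa> \<in> K \<Longrightarrow> \<eta> \<in> Xspace \<theta> \<Longrightarrow> normX \<theta> (\<eta> - \<kappa>) < \<rho> \<Longrightarrow> norm (h \<eta> - h \<kappa>) < e / 2"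
    using uniformly_continuous_near_precompact[OF _ K cont_h, of "e / 2"] delay_pos e by (metis half_gt_zero less_imp_le)
  \<comment> \<open>In this order: the neighbourhood of \<open>V_compare\<close>, the range of the
    flow estimate, and segments within \<open>\<rho>\<close> of \<open>K\<close>.\<close>
  define d where "d = min 1 (min \<delta> (\<rho> / \<Lambda>))"
  have "d > 0" using \<delta> \<rho> \<Lambda> by (simp add: d_def)
  have z: "normX \<theta> (\<xi>0 - \<xi>0) = 0" using delay_pos by (simp add: normX_diff_self)
  have "norm (V \<xi> - V \<xi>0) < e" if \<xi>: "\<xi> \<in> Xspace \<theta>" and near: "normX \<theta> (\<xi> - \<xi>0) < d" for \<xi>
  proof -
    have close: "norm (h (seg \<theta> x t) - h (seg \<theta> x0 t)) < e / 2"
      if "bounded_input R u" "sol_upto \<theta> f \<xi> u \<infinity> x" "sol_upto \<theta> f \<xi>0 u \<infinity> x0" "t \<in> {0..T}" for u x x0 t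
    proof (rule \<rho>(2))
      have "normX \<theta> (seg \<theta> x t - seg \<theta> x0 t) \<le> \<Lambda> * normX \<theta> (\<xi> - \<xi>0)"
        using near \<delta> z by (intro flow[OF that(1) \<xi> \<xi>0 _ _ that(2-4)]) (auto simp: d_def)
      also have "\<dots> < \<rho>" using near \<Lambda> by (simp add: d_def field_simps)
      finally show "normX \<theta> (seg \<theta> x t - seg \<theta> x0 t) < \<rho>" .
      show "seg \<theta> x0 t \<in> K" using inK that by blast
      show "seg \<theta> x t \<in> Xspace \<theta>" using seg_solution_in_Xspace[OF \<xi> that(2)] that(4) by simp
    qed
    have "V \<xi> \<le> max (e / 2) (V \<xi>0 + e / 2)"
    proof (rule cmp[OF \<xi> \<xi>0])
      fix u x1 x2 t assume "bounded_input R u" "sol_upto \<theta> f \<xi> u \<infinity> x1" "sol_upto \<theta> f \<xi>0 u \<infinity> x2" "t \<in> {0..T}"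
      from close[OF this] show "norm (h (seg \<theta> x1 t)) \<le> norm (h (seg \<theta> x2 t)) + e / 2"
        using norm_triangle_ineq2[of "h (seg \<theta> x1 t)" "h (seg \<theta> x2 t)"] by linarith
    qed (use near e in \<open>auto simp: d_def\<close>)
    moreover have "V \<xi>0 \<le> max (e / 2) (V \<xi> + e / 2)"
    proof (rule cmp[OF \<xi>0 \<xi>])
      fix u x1 x2 t assume "bounded_input R u" "sol_upto \<theta> f \<xi>0 u \<infinity> x1" "sol_upto \<theta> f \<xi> u \<infinity> x2" "t \<in> {0..T}"
      from close[OF this(1,3,2,4)] show "norm (h (seg \<theta> x1 t)) \<le> norm (h (seg \<theta> x2 t)) + e / 2"
        using norm_triangle_ineq3[of "h (seg \<theta> x2 t)" "h (seg \<theta> x1 t)"] by linarith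
    qed (use e z in auto)
    ultimately show ?thesis using V_nonneg[OF \<xi>] V_nonneg[OF \<xi>0] e by auto
  qed
  with \<open>d > 0\<close> show "\<exists>\<delta>>0. \<forall>\<eta>\<in>Xspace \<theta>. normX \<theta> (\<eta> - \<xi>0) < \<delta> \<longrightarrow> norm (V \<eta> - V \<xi>0) < e" by blast
qed

text \<open>Near \<open>\<xi>0\<close> the value of \<open>V\<close> exceeds the threshold
  \<open>c\<close>, half of \<open>V \<xi>0\<close>, so the threshold branch of
  \<open>V_compare\<close> is void. The constant \<open>L * \<Lambda>\<close>, for the output and
  for the flow, depends on \<open>c\<close> through the time horizon.\<close>

lemma V_locally_lipschitz:
  assumes h: "locally_lipschitz_X \<theta> (Xspace \<theta>) h"
  shows "locally_lipschitz_X \<theta> (Xspace \<theta> - {\<xi>. V \<xi> = 0}) V"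
  unfolding locally_lipschitz_X_def
proof (intro ballI)
  fix \<xi>0 assume "\<xi>0 \<in> Xspace \<theta> - {\<xi>. V \<xi> = 0}"
  then have \<xi>0: "\<xi>0 \<in> Xspace \<theta>" and pos: "V \<xi>0 > 0" using V_nonneg[of \<xi>0] by auto
  define c where "c = V \<xi>0 / 2"
  have c: "c > 0" using pos by (simp add: c_def)
  obtain R T where T: "T > 0" and cmp: "\<And>\<xi>1 \<xi>2 D. \<xi>1 \<in> Xspace \<theta> \<Longrightarrow> \<xi>2 \<in> Xspace \<theta> \<Longrightarrow> normX \<theta> (\<xi>1 - \<xi>0) < 1 \<Longrightarrow> D \<ge> 0 \<Longrightarrow>
      (\<And>u x1 x2 t. bounded_input R u \<Longrightarrow> sol_upto \<theta> f \<xi>1 u \<infinity> x1 \<Longrightarrow> sol_upto \<theta> f \<xi>2 u \<infinity> x2 \<Longrightarrow> t \<in> {0..T}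
        \<Longrightarrow> norm (h (seg \<theta> x1 t)) \<le> norm (h (seg \<theta> x2 t)) + D) \<Longrightarrow> V \<xi>1 \<le> max c (V \<xi>2 + D)"
    by (rule V_compare[OF \<xi>0 c]) blast
  obtain K \<delta> \<Lambda> where K: "K \<subseteq> Xspace \<theta>" "precompactX \<theta> K" and \<delta>: "\<delta> > 0" and \<Lambda>: "\<Lambda> > 0"
    and inK: "\<And>u x t. bounded_input R u \<Longrightarrow> sol_upto \<theta> f \<xi>0 u \<infinity> x \<Longrightarrow> t \<in> {0..T} \<Longrightarrow> seg \<theta> x t \<in> K"
    and flow: "\<And>u \<xi>1 \<xi>2 x1 x2 t. bounded_input R u \<Longrightarrow> \<xi>1 \<in> Xspace \<theta> \<Longrightarrow> \<xi>2 \<in> Xspace \<theta>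
      \<Longrightarrow> normX \<theta> (\<xi>1 - \<xi>0) < \<delta> \<Longrightarrow> normX \<theta> (\<xi>2 - \<xi>0) < \<delta>
      \<Longrightarrow> sol_upto \<theta> f \<xi>1 u \<infinity> x1 \<Longrightarrow> sol_upto \<theta> f \<xi>2 u \<infinity> x2 \<Longrightarrow> t \<in> {0..T}
      \<Longrightarrow> normX \<theta> (seg \<theta> x1 t - seg \<theta> x2 t) \<le> \<Lambda> * normX \<theta> (\<xi>1 - \<xi>2)"
    by (rule flow_lipschitz[OF rfc \<xi>0 T, where R = R]) blast
  \<comment> \<open>A dummy real input adapts \<open>h\<close> to
    \<open>uniformly_lipschitz_near_precompact\<close>, applied with input radius 0.\<close>
  have liph: "\<exists>\<delta>>0. \<exists>L. \<forall>\<xi>1\<in>Xspace \<theta>. \<forall>\<xi>2\<in>Xspace \<theta>. \<forall>w. normX \<theta> (\<xi>1 - \<xi>) < \<delta> \<and> normX \<theta> (\<xi>2 - \<xi>) < \<delta> \<and>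
      norm (w - v) < \<delta> \<longrightarrow> norm (h \<xi>1 - h \<xi>2) \<le> L * normX \<theta> (\<xi>1 - \<xi>2)" if "\<xi> \<in> Xspace \<theta>" for \<xi> and v :: real
    using h that unfolding locally_lipschitz_X_def by meson
  obtain \<rho> L where \<rho>: "\<rho> > 0" and L: "L > 0"
    and lip: "\<And>\<kappa> \<xi>1 \<xi>2 (w::real). \<kappa> \<in> K \<Longrightarrow> \<xi>1 \<in> Xspace \<theta> \<Longrightarrow> \<xi>2 \<in> Xspace \<theta> \<Longrightarrow> normX \<theta> (\<xi>1 - \<kappa>) < \<rho>
      \<Longrightarrow> normX \<theta> (\<xi>2 - \<kappa>) < \<rho> \<Longrightarrow> norm w \<le> 0 \<Longrightarrow> norm (h \<xi>1 - h \<xi>2) \<le> L * normX \<theta> (\<xi>1 - \<xi>2)"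
    by (rule uniformly_lipschitz_near_precompact[OF _ K, where g = "\<lambda>\<xi> _. h \<xi>" and r = 0, OF _ liph])
      (use delay_pos in auto)
  obtain \<delta>c where \<delta>c: "\<delta>c > 0" "\<And>\<eta>. \<eta> \<in> Xspace \<theta> \<Longrightarrow> normX \<theta> (\<eta> - \<xi>0) < \<delta>c \<Longrightarrow> norm (V \<eta> - V \<xi>0) < c"
    using V_continuous \<xi>0 c unfolding continuous_X_def by blast
  define d where "d = min (min 1 \<delta>c) (min \<delta> (\<rho> / \<Lambda>))"
  have "d > 0" using \<delta> \<rho> \<Lambda> \<delta>c by (simp add: d_def)
  have z: "normX \<theta> (\<xi>0 - \<xi>0) = 0" using delay_pos by (simp add: normX_diff_self)
  have le: "V \<xi>1 \<le> V \<xi>2 + L * \<Lambda> * normX \<theta> (\<xi>1 - \<xi>2)"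
    if \<xi>: "\<xi>1 \<in> Xspace \<theta>" "\<xi>2 \<in> Xspace \<theta>" and near: "normX \<theta> (\<xi>1 - \<xi>0) < d" "normX \<theta> (\<xi>2 - \<xi>0) < d" for \<xi>1 \<xi>2
  proof -
    have nn: "0 \<le> normX \<theta> (\<xi>1 - \<xi>2)" using delay_pos \<xi> by (simp add: normX_nonneg Xspace_diff)
    have tube: "normX \<theta> (seg \<theta> x t - seg \<theta> x0 t) < \<rho>"
      if "bounded_input R u" "\<xi> \<in> Xspace \<theta>" "normX \<theta> (\<xi> - \<xi>0) < d" "sol_upto \<theta> f \<xi> u \<infinity> x" "sol_upto \<theta> f \<xi>0 u \<infinity> x0"
        "t \<in> {0..T}" for u \<xi> x x0 t
    proof -
      have "normX \<theta> (seg \<theta> x t - seg \<theta> x0 t) \<le> \<Lambda> * normX \<theta> (\<xi> - \<xi>0)"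
        using that \<delta> z by (intro flow[OF that(1,2) \<xi>0 _ _ that(4-6)]) (auto simp: d_def)
      also have "\<dots> < \<rho>" using that \<Lambda> by (simp add: d_def field_simps)
      finally show ?thesis .
    qed
    have "V \<xi>1 \<le> max c (V \<xi>2 + L * \<Lambda> * normX \<theta> (\<xi>1 - \<xi>2))"
    proof (rule cmp[OF \<xi>])
      fix u x1 x2 t
      assume u: "bounded_input R u" and x: "sol_upto \<theta> f \<xi>1 u \<infinity> x1" "sol_upto \<theta> f \<xi>2 u \<infinity> x2" and t: "t \<in> {0..T}"
      obtain x0 where x0: "sol_upto \<theta> f \<xi>0 u \<infinity> x0" using global_solution[OF complete_flow \<xi>0 u] .
      have "norm (h (seg \<theta> x1 t) - h (seg \<theta> x2 t)) \<le> L * normX \<theta> (seg \<theta> x1 t - seg \<theta> x2 t)"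
        using t by (intro lip[OF inK[OF u x0 t] _ _ tube[OF u \<xi>(1) near(1) x(1) x0 t] tube[OF u \<xi>(2) near(2) x(2) x0 t], of 0]
          seg_solution_in_Xspace[OF \<xi>(1) x(1)] seg_solution_in_Xspace[OF \<xi>(2) x(2)]) auto
      also have "\<dots> \<le> L * (\<Lambda> * normX \<theta> (\<xi>1 - \<xi>2))"
        using near L by (intro mult_left_mono flow[OF u \<xi> _ _ x t]) (auto simp: d_def)
      finally show "norm (h (seg \<theta> x1 t)) \<le> norm (h (seg \<theta> x2 t)) + L * \<Lambda> * normX \<theta> (\<xi>1 - \<xi>2)"
        using norm_triangle_ineq2[of "h (seg \<theta> x1 t)" "h (seg \<theta> x2 t)"] by (simp add: mult.assoc)
    qed (use near nn L \<Lambda> in \<open>auto simp: d_def\<close>)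
    moreover have "V \<xi>1 > c"
      using \<delta>c(2)[OF \<xi>(1)] near(1) by (auto simp: d_def c_def abs_if split: if_splits)
    ultimately show ?thesis by auto
  qed
  have "norm (V \<xi>1 - V \<xi>2) \<le> L * \<Lambda> * normX \<theta> (\<xi>1 - \<xi>2)"
    if "\<xi>1 \<in> Xspace \<theta>" "\<xi>2 \<in> Xspace \<theta>" "normX \<theta> (\<xi>1 - \<xi>0) < d" "normX \<theta> (\<xi>2 - \<xi>0) < d" for \<xi>1 \<xi>2
    using le[OF that] le[OF that(2,1,4,3)] normX_commute[of \<theta> \<xi>1 \<xi>2] by (simp add: abs_le_iff)
  with \<open>d > 0\<close> show "\<exists>\<delta>>0. \<exists>L. \<forall>\<eta>1\<in>Xspace \<theta> - {\<xi>. V \<xi> = 0}. \<forall>\<eta>2\<in>Xspace \<theta> - {\<xi>. V \<xi> = 0}.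
      normX \<theta> (\<eta>1 - \<xi>0) < \<delta> \<and> normX \<theta> (\<eta>2 - \<xi>0) < \<delta> \<longrightarrow> norm (V \<eta>1 - V \<eta>2) \<le> L * normX \<theta> (\<eta>1 - \<eta>2)"
    by blast
qed

section \<open>Comparison bounds and stability of the redefined output\<close>

lemma V_output_redef: "output_redef \<theta> h V"
  unfolding output_redef_def
proof (intro conjI exI ballI)
  show "continuous_X \<theta> V" by (rule V_continuous)
  show "classKinf (\<lambda>s. s)" by (rule classKinf_ident)
  \<comment> \<open>\<open>\<beta> s 0\<close> is of class K in \<open>s\<close> but may be bounded;
    adding \<open>s\<close> makes it onto.\<close>
  show "classKinf (\<lambda>s. \<beta> s 0 + s)"
    using classKL_classN[OF \<beta>] by (intro classKinf_add_ident) simp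
  fix \<xi> :: "real \<Rightarrow> 'a" assume \<xi>: "\<xi> \<in> Xspace \<theta>"
  show "0 \<le> V \<xi>" by (rule V_nonneg[OF \<xi>])
  then show "norm (h \<xi>) \<le> \<bar>V \<xi>\<bar>" using norm_le_V[OF \<xi>] by simp
  show "\<bar>V \<xi>\<bar> \<le> \<beta> (normX \<theta> \<xi>) 0 + normX \<theta> \<xi>"
    using V_le[OF \<xi>] V_nonneg[OF \<xi>] normX_nonneg[OF _ \<xi>] delay_pos by simp
qed

lemma V_OL_IOS: "OL_IOS \<theta> f V"
  unfolding OL_IOS_def IOS_def
proof (intro conjI exI ballI allI impI)
  show "forward_complete \<theta> f" by (rule complete_flow)
  show "classKL \<beta>" by (rule \<beta>)
  show "classN gain" by (rule gain)
  \<comment> \<open>The sum \<open>V \<xi> + gain r\<close> is at most the maximum of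
    \<open>2 * V \<xi>\<close> and \<open>2 * gain r\<close>. One function has to serve both
    arguments of the maximum, so both terms appear in it.\<close>
  show "classN (\<lambda>s. 2 * s + 2 * gain s)"
    by (intro classN_add classN_cmult classN_ident gain) auto
  fix \<xi> u x t assume \<xi>: "\<xi> \<in> Xspace \<theta>" and u: "u \<in> inputs"
    and x: "sol_upto \<theta> f \<xi> u \<infinity> x \<and> normU u < \<infinity>" and t: "(t::real) \<ge> 0"
  have nn: "0 \<le> V (seg \<theta> x t)" using x t by (intro V_nonneg seg_solution_in_Xspace[OF \<xi>]) auto
  then show "norm (V (seg \<theta> x t)) \<le> \<beta> (normX \<theta> \<xi>) t + gain (real_of_ereal (normU u))"
    using V_along_solution(2)[OF \<xi> u _ _ t] x by simp
  define r where "r = real_of_ereal (normU u)"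
  have "r \<ge> 0" using normU_nonneg[of u] by (simp add: r_def real_of_ereal_pos)
  then have "V (seg \<theta> x t) \<le> V \<xi> + gain r" "gain r \<ge> 0" "gain (V \<xi>) \<ge> 0" "V \<xi> \<ge> 0"
    using V_along_solution(1)[OF \<xi> u _ _ t] x classN_nonneg[OF gain(1)] V_nonneg[OF \<xi>] by (auto simp: r_def)
  then show "norm (V (seg \<theta> x t)) \<le>
      max (2 * norm (V \<xi>) + 2 * gain (norm (V \<xi>))) (2 * real_of_ereal (normU u) + 2 * gain (real_of_ereal (normU u)))"
    using nn \<open>r \<ge> 0\<close> unfolding r_def[symmetric] by (auto simp: max_def)
qed

end

theorem theorem5p2:
  fixes \<theta> :: real
    and f :: "(real \<Rightarrow> real^'n) \<Rightarrow> real^'m \<Rightarrow> real^'n"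
    and h :: "(real \<Rightarrow> real^'n) \<Rightarrow> real^'p"
    and \<pi> :: "real \<Rightarrow> real"
  assumes "\<theta> > 0"
    and "locally_lipschitz_f \<theta> f"
    and "bounded_on_bounded \<theta> f"
    and "continuous_X \<theta> h"
    and "classN \<pi>"
    and "\<forall>\<xi>\<in>Xspace \<theta>. norm (h \<xi>) \<le> \<pi> (normX \<theta> \<xi>)"
    and "RFC \<theta> f"
  shows "(IOS \<theta> f h \<longleftrightarrow> (\<exists>hb. output_redef \<theta> h hb \<and> OL_IOS \<theta> f hb))
       \<and> (locally_lipschitz_X \<theta> (Xspace \<theta>) h \<and> IOS \<theta> f h \<longrightarrow>
            (\<exists>hb. output_redef \<theta> h hb \<and> OL_IOS \<theta> f hb \<and>
                  locally_lipschitz_X \<theta> (Xspace \<theta> - {\<xi>. hb \<xi> = 0}) hb))"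
proof -
  interpret delay_system \<theta> f by unfold_locales (fact assms)+
  \<comment> \<open>The same \<open>hb\<close> serves the equivalence and the Lipschitz
    supplement.\<close>
  have redef: "\<exists>hb. output_redef \<theta> h hb \<and> OL_IOS \<theta> f hb \<and>
      (locally_lipschitz_X \<theta> (Xspace \<theta>) h \<longrightarrow> locally_lipschitz_X \<theta> (Xspace \<theta> - {\<xi>. hb \<xi> = 0}) hb)"
    if ios: "IOS \<theta> f h"
  proof -
    obtain \<beta> \<gamma> where "classKL \<beta>" "classN \<gamma>" and
      est: "\<forall>\<xi>\<in>Xspace \<theta>. \<forall>u\<in>inputs. \<forall>x. sol_upto \<theta> f \<xi> u \<infinity> x \<and> normU u < \<infinity> \<longrightarrow>
           (\<forall>t\<ge>0. norm (h (seg \<theta> x t)) \<le> \<beta> (normX \<theta> \<xi>) t + \<gamma> (real_of_ereal (normU u)))"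
      using ios unfolding IOS_def by blast
    then interpret ios_system \<theta> f h \<beta> \<gamma>
    proof unfold_locales
      fix \<xi> u x and t :: real
      assume "\<xi> \<in> Xspace \<theta>" "u \<in> inputs" "sol_upto \<theta> f \<xi> u \<infinity> x" "normU u < \<infinity>" "t \<ge> 0"
      with est show "norm (h (seg \<theta> x t)) \<le> \<beta> (normX \<theta> \<xi>) t + \<gamma> (real_of_ereal (normU u))" by blast
    qed (use assms in simp_all)
    show ?thesis using V_output_redef V_OL_IOS V_locally_lipschitz by blast
  qed
  moreover have "IOS \<theta> f h" if "output_redef \<theta> h hb" "OL_IOS \<theta> f hb" for hb
    using that assms(1) seg_solution_in_Xspace by (intro IOS_of_output_redef[of \<theta> f h hb]) (auto simp: OL_IOS_def)
  ultimately show ?thesis by blast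
qed

end
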